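(* Let $S$ be a spray on $T_0M$ and let $\nabla$ be the dynamical covariant derivative induced by $S$. Then $S$ is gyroscopic if and only if there exists a Finsler structure $\widetilde F$ on $M$, with metric tensor $\widetilde g_{ij}=\frac12\frac{\partial^2\widetilde F^2}{\partial y^i\partial y^j}$, such that for all $i,j$ $$\nabla\left(\frac{1}{\widetilde F}\left(\widetilde g_{ij}-\frac{\partial\widetilde F}{\partial y^i}\frac{\partial\widetilde F}{\partial y^j}\right)\right)=0 .$$
   Context: $M$ is a connected, $n$-dimensional smooth manifold with local coordinates $(x^i)$; $TM$ is its tangent bundle, $T_0M=TM\setminus\{0\}$ is the slit tangent bundle (zero section removed), with induced local coordinates $(x^i,y^i)$. Summation over repeated indices is understood. Homogeneity always means positive homogeneity in the fibre coordinates $y$. Finsler structure: a continuous positive function $F:TM\to\mathbb{R}$ (positive on $T_0M$), smooth on $T_0M$, positively homogeneous of order $1$ in the fibre coordinates, such that the metric tensor $g_{ij}(x,y)=\frac12\frac{\partial^2F^2}{\partial y^i\partial y^j}(x,y)$ is non-degenerate on $T_0M$. Spray: a vector field $S$ on $T_0M$ that is locally of the form $S=y^i\frac{\partial}{\partial x^i}-2G^i(x,y)\frac{\partial}{\partial y^i}$ with $G^i$ smooth locally defined functions on $T_0M$, homogeneous of order $2$ in $y$ (equivalently $JS=\mathcal{C}$ and $[\mathcal{C},S]=S$, where $\mathcal{C}=y^i\frac{\partial}{\partial y^i}$ and $J=\frac{\partial}{\partial y^i}\otimes dx^i$). Gyroscopic spray: a spray $S$ is gyroscopic if there exist a basic $2$-form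 $\omega\in\Lambda^2(M)$ (a smooth $2$-form on $M$, with skew-symmetric components $\omega_{ij}(x)$ depending only on $x$) and a Finsler structure $\widetilde F$ such that $S\left(\frac{\partial\widetilde F}{\partial y^i}\right)-\frac{\partial\widetilde F}{\partial x^i}=\omega_{ij}y^j$ for all $i$. Dynamical covariant derivative induced by $S$: put $N^i_j=\frac{\partial G^i}{\partial y^j}$. On functions $\nabla f=S(f)$, and on the components of a $(0,2)$-type tensor field on $T_0M$, $\nabla g_{ij}=S(g_{ij})-N^k_i g_{kj}-N^k_j g_{ik}$. *)

theory Defs
  imports "HOL-Analysis.Analysis"
begin

section \<open>Smooth functions on open sets\<close>

text \<open>These notions are only used on open sets, where \<^term>\<open>at x\<close> and
  \<^term>\<open>at x within S\<close> agree.\<close>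

fun Ck_on :: "nat \<Rightarrow> 'a::real_normed_vector set \<Rightarrow> ('a \<Rightarrow> 'b::real_normed_vector) \<Rightarrow> bool" where
  "Ck_on 0 S f \<longleftrightarrow> continuous_on S f"
| "Ck_on (Suc k) S f \<longleftrightarrow>
     (\<forall>x\<in>S. f differentiable (at x)) \<and> (\<forall>v. Ck_on k S (\<lambda>x. frechet_derivative f (at x) v))"

definition smooth_on :: "'a::real_normed_vector set \<Rightarrow> ('a \<Rightarrow> 'b::real_normed_vector) \<Rightarrow> bool" where
  "smooth_on S f \<longleftrightarrow> (\<forall>k. Ck_on k S f)"

section \<open>Charts, atlases and tangent vectors\<close>

text \<open>A chart is its domain together with its coordinate map; the values of the coordinate map
  outside the domain are irrelevant.\<close>

type_synonym ('m, 'e) chart = "'m set \<times> ('m \<Rightarrow> 'e)"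

definition chart_image :: "('m, 'e) chart \<Rightarrow> 'e set" where
  "chart_image c = snd c ` fst c"

definition chart_inv :: "('m, 'e) chart \<Rightarrow> 'e \<Rightarrow> 'm" where
  "chart_inv c = inv_into (fst c) (snd c)"

definition transition :: "('m, 'e) chart \<Rightarrow> ('m, 'e) chart \<Rightarrow> 'e \<Rightarrow> 'e" where
  "transition c d = (\<lambda>x. snd d (chart_inv c x))"

definition smooth_atlas :: "('m::topological_space, 'e::real_normed_vector) chart set \<Rightarrow> bool" where
  "smooth_atlas A \<longleftrightarrow>
     (\<Union>c\<in>A. fst c) = UNIV \<and>
     (\<forall>c\<in>A. open (fst c) \<and> open (chart_image c) \<and>
        homeomorphism (fst c) (chart_image c) (snd c) (chart_inv c)) \<and>
     (\<forall>c\<in>A. \<forall>d\<in>A. smooth_on (snd c ` (fst c \<inter> fst d)) (transition c d))"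

text \<open>A tangent vector at \<open>p\<close> is given by its components in all charts around \<open>p\<close>, related by the
  differentials of the transition maps. It takes the value 0 on all other charts, so that equality
  of tangent vectors is equality of functions; the linear structure is pointwise.\<close>

type_synonym ('m, 'e) tvec = "('m, 'e) chart \<Rightarrow> 'e"

definition tangent_space :: "('m, 'e::real_normed_vector) chart set \<Rightarrow> 'm \<Rightarrow> ('m, 'e) tvec set" where
  "tangent_space A p = {v.
     (\<forall>c\<in>A. \<forall>d\<in>A. p \<in> fst c \<longrightarrow> p \<in> fst d \<longrightarrow>
        v d = frechet_derivative (transition c d) (at (snd c p)) (v c)) \<and>
     (\<forall>c. \<not> (c \<in> A \<and> p \<in> fst c) \<longrightarrow> v c = 0)}"

text \<open>The tangent vector at \<open>p\<close> with components \<open>w\<close> in the chart \<open>c\<close>.\<close>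

definition coord_vector ::
    "('m, 'e::real_normed_vector) chart set \<Rightarrow> ('m, 'e) chart \<Rightarrow> 'm \<Rightarrow> 'e \<Rightarrow> ('m, 'e) tvec" where
  "coord_vector A c p w = (\<lambda>d. if d \<in> A \<and> p \<in> fst d
     then frechet_derivative (transition c d) (at (snd c p)) w else 0)"

definition coord_rep :: "('m, 'e) chart \<Rightarrow> ('m \<Rightarrow> 'b) \<Rightarrow> 'e \<Rightarrow> 'b" where
  "coord_rep c f = (\<lambda>x. f (chart_inv c x))"

definition continuous_function ::
    "('m, 'e::real_normed_vector) chart set \<Rightarrow> ('m \<Rightarrow> 'b::real_normed_vector) \<Rightarrow> bool" where
  "continuous_function A f \<longleftrightarrow> (\<forall>c\<in>A. continuous_on (chart_image c) (coord_rep c f))"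

definition smooth_function ::
    "('m, 'e::real_normed_vector) chart set \<Rightarrow> ('m \<Rightarrow> 'b::real_normed_vector) \<Rightarrow> bool" where
  "smooth_function A f \<longleftrightarrow> (\<forall>c\<in>A. smooth_on (chart_image c) (coord_rep c f))"

definition vector_rep ::
    "('m, 'e) chart \<Rightarrow> ('m \<Rightarrow> ('m, 'e) tvec) \<Rightarrow> 'e \<Rightarrow> 'e" where
  "vector_rep c X = (\<lambda>x. X (chart_inv c x) c)"

definition vector_field ::
    "('m, 'e::real_normed_vector) chart set \<Rightarrow> ('m \<Rightarrow> ('m, 'e) tvec) \<Rightarrow> bool" where
  "vector_field A X \<longleftrightarrow>
     (\<forall>p\<in>(\<Union>c\<in>A. fst c). X p \<in> tangent_space A p) \<and>
     (\<forall>c\<in>A. smooth_on (chart_image c) (vector_rep c X))"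

definition two_form_comp ::
    "('m, real^'n) chart set \<Rightarrow> ('m, real^'n) chart \<Rightarrow>
     ('m \<Rightarrow> ('m, real^'n) tvec \<Rightarrow> ('m, real^'n) tvec \<Rightarrow> real) \<Rightarrow> 'n \<Rightarrow> 'n \<Rightarrow> real^'n \<Rightarrow> real" where
  "two_form_comp A c \<omega> i j = (\<lambda>x. let p = chart_inv c x in
     \<omega> p (coord_vector A c p (axis i 1)) (coord_vector A c p (axis j 1)))"

definition two_form ::
    "('m, real^'n) chart set \<Rightarrow> ('m \<Rightarrow> ('m, real^'n) tvec \<Rightarrow> ('m, real^'n) tvec \<Rightarrow> real) \<Rightarrow> bool" where
  "two_form A \<omega> \<longleftrightarrow>
     (\<forall>p. \<forall>u\<in>tangent_space A p. \<forall>v\<in>tangent_space A p. \<omega> p u v = - \<omega> p v u) \<and>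
     (\<forall>p. \<forall>u\<in>tangent_space A p. \<forall>v\<in>tangent_space A p. \<forall>w\<in>tangent_space A p. \<forall>a b.
        \<omega> p (\<lambda>c. a *\<^sub>R u c + b *\<^sub>R v c) w = a * \<omega> p u w + b * \<omega> p v w) \<and>
     (\<forall>c\<in>A. \<forall>i j. smooth_on (chart_image c) (two_form_comp A c \<omega> i j))"

section \<open>Tangent bundle and slit tangent bundle\<close>

type_synonym ('m, 'n) tpoint = "'m \<times> ('m, real^'n) tvec"

definition tangent_bundle :: "('m, real^'n) chart set \<Rightarrow> ('m, 'n) tpoint set" where
  "tangent_bundle A = {(p, v). v \<in> tangent_space A p}"

definition slit_bundle :: "('m, real^'n) chart set \<Rightarrow> ('m, 'n) tpoint set" where
  "slit_bundle A = {(p, v). v \<in> tangent_space A p \<and> v \<noteq> (\<lambda>_. 0)}"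

definition bundle_chart ::
    "('m, real^'n) chart set \<Rightarrow> ('m, real^'n) chart \<Rightarrow>
     (('m, 'n) tpoint, (real^'n) \<times> (real^'n)) chart" where
  "bundle_chart A c =
     ({(p, v). (p, v) \<in> tangent_bundle A \<and> p \<in> fst c}, \<lambda>(p, v). (snd c p, v c))"

definition slit_chart ::
    "('m, real^'n) chart set \<Rightarrow> ('m, real^'n) chart \<Rightarrow>
     (('m, 'n) tpoint, (real^'n) \<times> (real^'n)) chart" where
  "slit_chart A c =
     ({(p, v). (p, v) \<in> slit_bundle A \<and> p \<in> fst c}, \<lambda>(p, v). (snd c p, v c))"

definition bundle_atlas ::
    "('m, real^'n) chart set \<Rightarrow> (('m, 'n) tpoint, (real^'n) \<times> (real^'n)) chart set" where
  "bundle_atlas A = bundle_chart A ` A"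

definition slit_atlas ::
    "('m, real^'n) chart set \<Rightarrow> (('m, 'n) tpoint, (real^'n) \<times> (real^'n)) chart set" where
  "slit_atlas A = slit_chart A ` A"

definition dx :: "'n \<Rightarrow> ((real^'n) \<times> (real^'n) \<Rightarrow> real) \<Rightarrow> (real^'n) \<times> (real^'n) \<Rightarrow> real" where
  "dx i f = (\<lambda>z. frechet_derivative f (at z) (axis i 1, 0))"

definition dy :: "'n \<Rightarrow> ((real^'n) \<times> (real^'n) \<Rightarrow> real) \<Rightarrow> (real^'n) \<times> (real^'n) \<Rightarrow> real" where
  "dy i f = (\<lambda>z. frechet_derivative f (at z) (0, axis i 1))"

section \<open>Finsler structures\<close>

definition slit_rep ::
    "('m, real^'n) chart set \<Rightarrow> ('m, real^'n) chart \<Rightarrow> (('m, 'n) tpoint \<Rightarrow> real) \<Rightarrow>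
     (real^'n) \<times> (real^'n) \<Rightarrow> real" where
  "slit_rep A c F = coord_rep (slit_chart A c) F"

definition metric_tensor ::
    "('m, real^'n) chart set \<Rightarrow> ('m, real^'n) chart \<Rightarrow> (('m, 'n) tpoint \<Rightarrow> real) \<Rightarrow>
     'n \<Rightarrow> 'n \<Rightarrow> (real^'n) \<times> (real^'n) \<Rightarrow> real" where
  "metric_tensor A c F i j = (\<lambda>z. 1/2 * dy i (dy j (\<lambda>w. (slit_rep A c F w)\<^sup>2)) z)"

definition finsler :: "('m, real^'n) chart set \<Rightarrow> (('m, 'n) tpoint \<Rightarrow> real) \<Rightarrow> bool" where
  "finsler A F \<longleftrightarrow>
     continuous_function (bundle_atlas A) F \<and>
     (\<forall>q\<in>slit_bundle A. F q > 0) \<and>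
     smooth_function (slit_atlas A) F \<and>
     (\<forall>(p, v)\<in>tangent_bundle A. \<forall>t>0. F (p, \<lambda>c. t *\<^sub>R v c) = t * F (p, v)) \<and>
     (\<forall>c\<in>A. \<forall>z\<in>chart_image (slit_chart A c). det (\<chi> i j. metric_tensor A c F i j z) \<noteq> 0)"

section \<open>Sprays and the dynamical covariant derivative\<close>

type_synonym ('m, 'n) slit_field =
  "('m, 'n) tpoint \<Rightarrow> (('m, 'n) tpoint, (real^'n) \<times> (real^'n)) tvec"

text \<open>The coefficients \<open>G\<close> are read off from the local form
  \<open>S = y\<^sup>i \<partial>/\<partial>x\<^sup>i - 2 G\<^sup>i \<partial>/\<partial>y\<^sup>i\<close>, i.e. the components of \<open>S\<close> are \<open>(y, -2 G)\<close>.\<close>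

definition spray_coeff ::
    "('m, real^'n) chart set \<Rightarrow> ('m, real^'n) chart \<Rightarrow> ('m, 'n) slit_field \<Rightarrow>
     (real^'n) \<times> (real^'n) \<Rightarrow> real^'n" where
  "spray_coeff A c S = (\<lambda>z. - (1/2) *\<^sub>R snd (vector_rep (slit_chart A c) S z))"

definition spray :: "('m, real^'n) chart set \<Rightarrow> ('m, 'n) slit_field \<Rightarrow> bool" where
  "spray A S \<longleftrightarrow>
     vector_field (slit_atlas A) S \<and>
     (\<forall>c\<in>A. let D = chart_image (slit_chart A c); G = spray_coeff A c S in
        smooth_on D G \<and>
        (\<forall>(x, y)\<in>D. \<forall>t>0. G (x, t *\<^sub>R y) = t\<^sup>2 *\<^sub>R G (x, y)) \<and>
        (\<forall>(x, y)\<in>D. vector_rep (slit_chart A c) S (x, y) = (y, - 2 *\<^sub>R G (x, y))))"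

text \<open>The derivative \<open>S(f)\<close> of a local function \<open>f(x, y)\<close>.\<close>

definition spray_deriv ::
    "('m, real^'n) chart set \<Rightarrow> ('m, real^'n) chart \<Rightarrow> ('m, 'n) slit_field \<Rightarrow>
     ((real^'n) \<times> (real^'n) \<Rightarrow> real) \<Rightarrow> (real^'n) \<times> (real^'n) \<Rightarrow> real" where
  "spray_deriv A c S f =
     (\<lambda>z. frechet_derivative f (at z) (vector_rep (slit_chart A c) S z))"

definition nonlinear_conn ::
    "('m, real^'n) chart set \<Rightarrow> ('m, real^'n) chart \<Rightarrow> ('m, 'n) slit_field \<Rightarrow>
     'n \<Rightarrow> 'n \<Rightarrow> (real^'n) \<times> (real^'n) \<Rightarrow> real" where
  "nonlinear_conn A c S i j = dy j (\<lambda>z. spray_coeff A c S z $ i)"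

definition nabla ::
    "('m, real^'n) chart set \<Rightarrow> ('m, real^'n) chart \<Rightarrow> ('m, 'n) slit_field \<Rightarrow>
     ('n \<Rightarrow> 'n \<Rightarrow> (real^'n) \<times> (real^'n) \<Rightarrow> real) \<Rightarrow>
     'n \<Rightarrow> 'n \<Rightarrow> (real^'n) \<times> (real^'n) \<Rightarrow> real" where
  "nabla A c S h i j = (\<lambda>z. spray_deriv A c S (h i j) z
     - (\<Sum>k\<in>UNIV. nonlinear_conn A c S k i z * h k j z)
     - (\<Sum>k\<in>UNIV. nonlinear_conn A c S k j z * h i k z))"

definition gyroscopic :: "('m, real^'n) chart set \<Rightarrow> ('m, 'n) slit_field \<Rightarrow> bool" where
  "gyroscopic A S \<longleftrightarrow>
     (\<exists>\<omega> F. two_form A \<omega> \<and> finsler A F \<and>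
        (\<forall>c\<in>A. \<forall>(x, y)\<in>chart_image (slit_chart A c). \<forall>i.
           spray_deriv A c S (dy i (slit_rep A c F)) (x, y) - dx i (slit_rep A c F) (x, y)
             = (\<Sum>j\<in>UNIV. two_form_comp A c \<omega> i j x * y $ j)))"

end

theory Submission
  imports Defs
begin

text \<open>Write \<open>h\<^sub>i\<^sub>j = (g\<^sub>i\<^sub>j - F\<^sub>i F\<^sub>j) / F\<close>, with lower indices on \<open>F\<close> for derivatives in the fibre coordinates.
Since \<open>g\<^sub>i\<^sub>j = F F\<^sub>i\<^sub>j + F\<^sub>i F\<^sub>j\<close>, the tensor \<open>h\<close> is the fibre Hessian \<open>F\<^sub>i\<^sub>j\<close>. Let
\<open>\<delta>\<^sub>i = S(F\<^sub>i) - \<partial>F/\<partial>x\<^sup>i\<close> be the Euler-Lagrange expression of \<open>F\<close> along the spray \<open>S\<close>. From the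
commutator of \<open>S\<close> with \<open>\<partial>/\<partial>y\<^sup>j\<close> one gets
\<open>\<partial>\<delta>\<^sub>i/\<partial>y\<^sup>j = S(F\<^sub>i\<^sub>j) + \<partial>F\<^sub>i/\<partial>x\<^sup>j - \<partial>F\<^sub>j/\<partial>x\<^sup>i - 2 N\<^sup>k\<^sub>j F\<^sub>k\<^sub>i\<close>,
and the symmetric part of the right hand side is exactly \<open>\<nabla> h\<^sub>i\<^sub>j\<close> (\<open>nabla_angular_metric\<close>). So
\<open>\<nabla> h = 0\<close> means that the matrix \<open>\<partial>\<delta>\<^sub>i/\<partial>y\<^sup>j\<close> is skew, and both directions work with one and the same
Finsler structure.

If \<open>S\<close> is gyroscopic, then \<open>\<delta>\<^sub>i = \<omega>\<^sub>i\<^sub>j(x) y\<^sup>j\<close> has the skew vertical derivative \<open>\<omega>\<^sub>i\<^sub>j\<close>.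

Conversely, let the vertical derivative of \<open>\<delta>\<close> be skew. Then \<open>\<partial>\<^sup>2\<delta>\<^sub>i/\<partial>y\<^sup>j\<partial>y\<^sup>k\<close> is symmetric in \<open>j, k\<close> and
skew in \<open>i, j\<close>, hence zero, and the vertical derivative is constant on each punctured fibre
(\<open>dir_deriv_skew_constant\<close>; dimension one, where the punctured fibre is disconnected, is
immediate). As \<open>\<delta>\<close> is homogeneous of degree one in \<open>y\<close>, it follows that \<open>\<delta>\<^sub>i = \<omega>\<^sub>i\<^sub>j(x) y\<^sup>j\<close> with
skew \<open>\<omega>\<close>. In terms of vectors: the number \<open>\<delta>\<^sub>y(u)\<close>, the value on \<open>u\<close> of the form at the point \<open>y\<close>, is
skew in \<open>u\<close> and \<open>y\<close> (\<open>euler_lagrange_form_skew\<close>), and it is linear in \<open>u\<close>. This number is therefore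
the candidate for \<open>\<omega>(u, y)\<close>. It does not depend on the chart, because the second derivatives of a
coordinate change drop out of \<open>\<delta>\<close> (\<open>euler_lagrange_tangent_map\<close>), and so it defines a global two-form.\<close>

section \<open>Directional derivatives of smooth functions\<close>

definition dir_deriv ::
    "'a::real_normed_vector \<Rightarrow> ('a \<Rightarrow> 'b::real_normed_vector) \<Rightarrow> 'a \<Rightarrow> 'b" where
  "dir_deriv v f = (\<lambda>z. frechet_derivative f (at z) v)"

lemma Ck_on_Suc_dir_deriv:
  "Ck_on (Suc k) S f \<longleftrightarrow> (\<forall>x\<in>S. f differentiable (at x)) \<and> (\<forall>v. Ck_on k S (dir_deriv v f))"
  by (simp add: dir_deriv_def)

declare Ck_on.simps(2) [simp del]

lemma has_derivative_dir_deriv: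
  "f differentiable (at z) \<Longrightarrow> (f has_derivative (\<lambda>h. dir_deriv h f z)) (at z)"
  by (simp add: dir_deriv_def frechet_derivative_works[symmetric])

lemma dir_deriv_eq: "(f has_derivative f') (at z) \<Longrightarrow> dir_deriv v f z = f' v"
  unfolding dir_deriv_def by (metis frechet_derivative_at)

lemma linear_dir_deriv: "f differentiable (at z) \<Longrightarrow> linear (\<lambda>v. dir_deriv v f z)"
  unfolding dir_deriv_def by (simp add: linear_frechet_derivative)

lemma dir_deriv_cong:
  assumes "open S" "z \<in> S" "\<And>x. x \<in> S \<Longrightarrow> f x = g x" "f differentiable (at z)"
  shows "dir_deriv v f z = dir_deriv v g z"
  unfolding dir_deriv_def
  by (metis frechet_derivative_transform_within_open[OF assms(4,1,2,3)])

lemma differentiable_cong_open: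
  assumes "open S" "z \<in> S" "\<And>x. x \<in> S \<Longrightarrow> f x = g x" "f differentiable (at z)"
  shows "g differentiable (at z)"
  using assms has_derivative_transform_within_open unfolding differentiable_def by metis

text \<open>The class \<open>C\<^sup>k\<close> is defined through total functions and \<^const>\<open>frechet_derivative\<close>, which picks an
arbitrary value where there is no derivative. Openness of the domain makes derivatives local, so
that only the values on the domain matter.\<close>

lemma Ck_on_cong:
  assumes "open S"
  shows "\<lbrakk>\<And>x. x \<in> S \<Longrightarrow> f x = g x; Ck_on k S f\<rbrakk> \<Longrightarrow> Ck_on k S g"
proof (induction k arbitrary: f g)
  case 0
  then show ?case by (metis Ck_on.simps(1) continuous_on_cong)
next
  case (Suc k)
  have "\<And>x. x \<in> S \<Longrightarrow> g differentiable (at x)"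
    using differentiable_cong_open[OF assms _ Suc.prems(1)] Suc.prems(2)
    by (auto simp: Ck_on_Suc_dir_deriv)
  moreover have "Ck_on k S (dir_deriv v g)" for v
  proof (rule Suc.IH)
    show "Ck_on k S (dir_deriv v f)" using Suc.prems(2) by (simp add: Ck_on_Suc_dir_deriv)
    show "dir_deriv v f x = dir_deriv v g x" if "x \<in> S" for x
      using dir_deriv_cong[OF assms that Suc.prems(1)] Suc.prems(2) that
      by (auto simp: Ck_on_Suc_dir_deriv)
  qed
  ultimately show ?case by (simp add: Ck_on_Suc_dir_deriv)
qed

lemma Ck_on_lower: "Ck_on (Suc k) S f \<Longrightarrow> Ck_on k S f"
proof (induction k arbitrary: f)
  case 0
  then show ?case
    by (auto simp: Ck_on_Suc_dir_deriv intro!: continuous_at_imp_continuous_on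
        differentiable_imp_continuous_within)
qed (auto simp: Ck_on_Suc_dir_deriv)

lemma smooth_on_iff_dir_deriv:
  "smooth_on S f \<longleftrightarrow> (\<forall>x\<in>S. f differentiable (at x)) \<and> (\<forall>v. smooth_on S (dir_deriv v f))"
  unfolding smooth_on_def by (metis Ck_on_Suc_dir_deriv Ck_on_lower)

lemma smooth_on_differentiable: "smooth_on S f \<Longrightarrow> z \<in> S \<Longrightarrow> f differentiable (at z)"
  using smooth_on_iff_dir_deriv by blast

lemma smooth_on_dir_deriv: "smooth_on S f \<Longrightarrow> smooth_on S (dir_deriv v f)"
  using smooth_on_iff_dir_deriv by blast

lemma smooth_on_continuous: "smooth_on S f \<Longrightarrow> continuous_on S f"
  unfolding smooth_on_def by (metis Ck_on.simps(1))

lemma smooth_on_cong: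
  "\<lbrakk>smooth_on S f; open S; \<And>x. x \<in> S \<Longrightarrow> f x = g x\<rbrakk> \<Longrightarrow> smooth_on S g"
  unfolding smooth_on_def using Ck_on_cong by blast

lemma Ck_on_const: "Ck_on k S (\<lambda>x. c)"
  by (induction k arbitrary: c) (auto simp: Ck_on_Suc_dir_deriv dir_deriv_def)

lemma smooth_on_const: "smooth_on S (\<lambda>x. c)"
  by (simp add: smooth_on_def Ck_on_const)

lemma Ck_on_add:
  assumes "open S"
  shows "\<lbrakk>Ck_on k S f; Ck_on k S g\<rbrakk> \<Longrightarrow> Ck_on k S (\<lambda>x. f x + g x)"
proof (induction k arbitrary: f g)
  case 0
  then show ?case by (simp add: continuous_on_add)
next
  case (Suc k)
  have d: "f differentiable (at x)" "g differentiable (at x)" if "x \<in> S" for x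
    using Suc.prems that by (auto simp: Ck_on_Suc_dir_deriv)
  have "Ck_on k S (dir_deriv v (\<lambda>x. f x + g x))" for v
  proof (rule Ck_on_cong[OF assms])
    show "Ck_on k S (\<lambda>x. dir_deriv v f x + dir_deriv v g x)"
      using Suc by (simp add: Ck_on_Suc_dir_deriv)
    show "dir_deriv v f x + dir_deriv v g x = dir_deriv v (\<lambda>x. f x + g x) x" if "x \<in> S" for x
      by (rule dir_deriv_eq[symmetric]) (intro derivative_intros has_derivative_dir_deriv d that)
  qed
  then show ?case using d by (auto simp: Ck_on_Suc_dir_deriv)
qed

lemma smooth_on_add:
  "\<lbrakk>open S; smooth_on S f; smooth_on S g\<rbrakk> \<Longrightarrow> smooth_on S (\<lambda>x. f x + g x)"
  by (simp add: smooth_on_def Ck_on_add)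

lemma smooth_on_sum:
  "\<lbrakk>open S; \<And>i. i \<in> I \<Longrightarrow> smooth_on S (f i)\<rbrakk> \<Longrightarrow> smooth_on S (\<lambda>x. \<Sum>i\<in>I. f i x)"
  by (induction I rule: infinite_finite_induct) (auto simp: smooth_on_const smooth_on_add)

text \<open>In the Leibniz rule the undifferentiated factors are needed one class lower than they are given;
this is where \<open>Ck_on_lower\<close> enters the induction.\<close>

lemma Ck_on_mult:
  fixes f g :: "'a::real_normed_vector \<Rightarrow> real"
  assumes "open S"
  shows "\<lbrakk>Ck_on k S f; Ck_on k S g\<rbrakk> \<Longrightarrow> Ck_on k S (\<lambda>x. f x * g x)"
proof (induction k arbitrary: f g)
  case 0
  then show ?case by (simp add: continuous_on_mult)
next
  case (Suc k)
  have d: "f differentiable (at x)" "g differentiable (at x)" if "x \<in> S" for x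
    using Suc.prems that by (auto simp: Ck_on_Suc_dir_deriv)
  have "Ck_on k S (dir_deriv v (\<lambda>x. f x * g x))" for v
  proof (rule Ck_on_cong[OF assms])
    show "Ck_on k S (\<lambda>x. f x * dir_deriv v g x + dir_deriv v f x * g x)"
      using Suc.prems Ck_on_lower[OF Suc.prems(1)] Ck_on_lower[OF Suc.prems(2)]
      by (intro Ck_on_add[OF assms] Suc.IH) (simp_all add: Ck_on_Suc_dir_deriv)
    show "f x * dir_deriv v g x + dir_deriv v f x * g x = dir_deriv v (\<lambda>x. f x * g x) x"
      if "x \<in> S" for x
      by (rule dir_deriv_eq[symmetric]) (intro derivative_intros has_derivative_dir_deriv d that)
  qed
  then show ?case using d by (auto simp: Ck_on_Suc_dir_deriv)
qed

lemma smooth_on_mult: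
  fixes f g :: "'a::real_normed_vector \<Rightarrow> real"
  shows "\<lbrakk>open S; smooth_on S f; smooth_on S g\<rbrakk> \<Longrightarrow> smooth_on S (\<lambda>x. f x * g x)"
  by (simp add: smooth_on_def Ck_on_mult)

lemma Ck_on_linear_image:
  assumes "open S" "bounded_linear L"
  shows "Ck_on k S f \<Longrightarrow> Ck_on k S (\<lambda>x. L (f x))"
proof (induction k arbitrary: f)
  case 0
  then show ?case using assms(2) by (simp add: bounded_linear.continuous_on)
next
  case (Suc k)
  have d: "((\<lambda>x. L (f x)) has_derivative (\<lambda>h. L (dir_deriv h f x))) (at x)" if "x \<in> S" for x
    using Suc.prems that
    by (intro bounded_linear.has_derivative[OF assms(2)] has_derivative_dir_deriv)
      (auto simp: Ck_on_Suc_dir_deriv)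
  have "Ck_on k S (dir_deriv v (\<lambda>x. L (f x)))" for v
    by (rule Ck_on_cong[OF assms(1), where f = "\<lambda>x. L (dir_deriv v f x)"])
      (use Suc in \<open>auto simp: dir_deriv_eq[OF d] Ck_on_Suc_dir_deriv\<close>)
  then show ?case using d by (auto simp: Ck_on_Suc_dir_deriv differentiable_def)
qed

lemma smooth_on_linear_image:
  "\<lbrakk>open S; bounded_linear L; smooth_on S f\<rbrakk> \<Longrightarrow> smooth_on S (\<lambda>x. L (f x))"
  by (simp add: smooth_on_def Ck_on_linear_image)

lemma has_derivative_compose_affine:
  assumes "bounded_linear L" "f differentiable (at (L x + a))"
  shows "((\<lambda>x. f (L x + a)) has_derivative (\<lambda>h. dir_deriv (L h) f (L x + a))) (at x)"
proof -
  have "((\<lambda>x. L x + a) has_derivative L) (at x)"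
    using has_derivative_add[OF bounded_linear_imp_has_derivative[OF assms(1)] has_derivative_const[of a]]
    by simp
  from diff_chain_at[OF this has_derivative_dir_deriv[OF assms(2)]]
  show ?thesis by (simp add: o_def)
qed

text \<open>Composition with affine maps is the only composition rule for the classes \<open>C\<^sup>k\<close> that is needed
below: it restricts smooth functions on the tangent bundle to a fibre, or to the
points of a constant vector field.\<close>

lemma Ck_on_compose_affine:
  assumes "open U" "bounded_linear L" "\<And>x. x \<in> U \<Longrightarrow> L x + a \<in> S"
  shows "Ck_on k S f \<Longrightarrow> Ck_on k U (\<lambda>x. f (L x + a))"
proof (induction k arbitrary: f)
  case 0
  have "continuous_on U (\<lambda>x. L x + a)"
    by (rule continuous_on_add[OF linear_continuous_on[OF assms(2)] continuous_on_const])
  from continuous_on_compose2[OF 0[unfolded Ck_on.simps] this] show ?case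
    using assms(3) by (simp add: image_subset_iff)
next
  case (Suc k)
  have d: "((\<lambda>x. f (L x + a)) has_derivative (\<lambda>h. dir_deriv (L h) f (L x + a))) (at x)"
    if "x \<in> U" for x
    using has_derivative_compose_affine[OF assms(2)] assms(3)[OF that] Suc.prems
    by (auto simp: Ck_on_Suc_dir_deriv)
  have "Ck_on k U (dir_deriv v (\<lambda>x. f (L x + a)))" for v
    by (rule Ck_on_cong[OF assms(1), where f = "\<lambda>x. dir_deriv (L v) f (L x + a)"])
      (use Suc in \<open>auto simp: dir_deriv_eq[OF d] Ck_on_Suc_dir_deriv\<close>)
  then show ?case using d by (auto simp: Ck_on_Suc_dir_deriv differentiable_def)
qed

lemma smooth_on_compose_affine:
  "\<lbrakk>open U; bounded_linear L; \<And>x. x \<in> U \<Longrightarrow> L x + a \<in> S; smooth_on S f\<rbrakk>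
    \<Longrightarrow> smooth_on U (\<lambda>x. f (L x + a))"
  unfolding smooth_on_def using Ck_on_compose_affine by blast

lemma has_real_derivative_along_line:
  fixes f :: "'a::real_normed_vector \<Rightarrow> real"
  assumes "f differentiable (at (a + s *\<^sub>R v))"
  shows "((\<lambda>s. f (a + s *\<^sub>R v)) has_real_derivative dir_deriv v f (a + s *\<^sub>R v)) (at s)"
proof -
  have "((\<lambda>s. a + s *\<^sub>R v) has_derivative (\<lambda>h. h *\<^sub>R v)) (at s)"
    by (auto intro!: derivative_eq_intros)
  from diff_chain_at[OF this has_derivative_dir_deriv[OF assms]]
  show ?thesis
    by (simp add: has_field_derivative_def o_def linear_cmul[OF linear_dir_deriv[OF assms]]
        mult_commute_abs)
qed

text \<open>The theorem of Schwarz. By two applications of the mean value theorem the second difference of \<open>f\<close>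
over the parallelogram spanned by \<open>t v\<close> and \<open>t w\<close> is \<open>t\<^sup>2\<close> times a mixed derivative at a point of
that parallelogram, in either order of differentiation. The two mixed derivatives therefore agree
at two points near \<open>z\<close>, and by continuity at \<open>z\<close>.\<close>

lemma dir_deriv_commute_real:
  fixes f :: "'a::real_normed_vector \<Rightarrow> real"
  assumes S: "open S" "z \<in> S" and f: "smooth_on S f"
  shows "dir_deriv v (dir_deriv w f) z = dir_deriv w (dir_deriv v f) z"
proof -
  have mvt: "\<exists>\<xi> \<eta>. 0 < \<xi> \<and> \<xi> < t \<and> 0 < \<eta> \<and> \<eta> < t \<and>
      f (z + t *\<^sub>R v + t *\<^sub>R w) - f (z + t *\<^sub>R v) - f (z + t *\<^sub>R w) + f z
        = t * t * dir_deriv w (dir_deriv v f) (z + \<xi> *\<^sub>R v + \<eta> *\<^sub>R w)"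
    if t: "0 < t" and inS: "\<And>a b. \<lbrakk>0 \<le> a; a \<le> t; 0 \<le> b; b \<le> t\<rbrakk> \<Longrightarrow> z + a *\<^sub>R v + b *\<^sub>R w \<in> S"
    for t v w
  proof -
    \<comment> \<open>The second difference is the increment of \<open>\<phi>\<close> from 0 to \<open>t\<close>.\<close>
    define \<phi> where "\<phi> s = f (z + s *\<^sub>R v + t *\<^sub>R w) - f (z + s *\<^sub>R v)" for s
    have d\<phi>: "(\<phi> has_real_derivative
        (dir_deriv v f (z + s *\<^sub>R v + t *\<^sub>R w) - dir_deriv v f (z + s *\<^sub>R v))) (at s)"
      if s: "0 \<le> s" "s \<le> t" for s
    proof -
      have dif: "f differentiable at (z + t *\<^sub>R w + s *\<^sub>R v)" "f differentiable at (z + s *\<^sub>R v)"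
        using inS[of s t] inS[of s 0] s t smooth_on_differentiable[OF f] by (simp_all add: add_ac)
      have "((\<lambda>s. f (z + t *\<^sub>R w + s *\<^sub>R v) - f (z + s *\<^sub>R v)) has_real_derivative
        (dir_deriv v f (z + t *\<^sub>R w + s *\<^sub>R v) - dir_deriv v f (z + s *\<^sub>R v))) (at s)"
        by (intro DERIV_diff has_real_derivative_along_line dif)
      then show ?thesis by (simp add: \<phi>_def[abs_def] add_ac)
    qed
    obtain \<xi> where \<xi>: "0 < \<xi>" "\<xi> < t" "\<phi> t - \<phi> 0 = (t - 0) *
        (dir_deriv v f (z + \<xi> *\<^sub>R v + t *\<^sub>R w) - dir_deriv v f (z + \<xi> *\<^sub>R v))"
      using MVT2[OF t, where f' = "\<lambda>s. dir_deriv v f (z + s *\<^sub>R v + t *\<^sub>R w)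
        - dir_deriv v f (z + s *\<^sub>R v)", OF d\<phi>] by auto
    define \<psi> where "\<psi> s = dir_deriv v f (z + \<xi> *\<^sub>R v + s *\<^sub>R w)" for s
    have d\<psi>: "(\<psi> has_real_derivative (dir_deriv w (dir_deriv v f) (z + \<xi> *\<^sub>R v + s *\<^sub>R w))) (at s)"
      if s: "0 \<le> s" "s \<le> t" for s
      unfolding \<psi>_def
      by (rule has_real_derivative_along_line)
        (use inS[of \<xi> s] s \<xi> smooth_on_differentiable[OF smooth_on_dir_deriv[OF f]] in simp)
    obtain \<eta> where \<eta>: "0 < \<eta>" "\<eta> < t" "\<psi> t - \<psi> 0 = (t - 0) *
        dir_deriv w (dir_deriv v f) (z + \<xi> *\<^sub>R v + \<eta> *\<^sub>R w)"
      using MVT2[OF t, OF d\<psi>] by auto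
    show ?thesis
      using \<xi> \<eta> by (intro exI[of _ \<xi>] exI[of _ \<eta>]) (auto simp: \<phi>_def \<psi>_def algebra_simps)
  qed
  have "\<bar>dir_deriv v (dir_deriv w f) z - dir_deriv w (dir_deriv v f) z\<bar> \<le> e" if "e > 0" for e
  proof -
    have cont: "continuous_on S (dir_deriv p (dir_deriv q f))" for p q
      by (intro smooth_on_continuous smooth_on_dir_deriv f)
    obtain r0 where r0: "r0 > 0" "ball z r0 \<subseteq> S" using S open_contains_ball by metis
    have "\<exists>r>0. \<forall>x\<in>S. dist x z < r \<longrightarrow>
        dist (dir_deriv p (dir_deriv q f) x) (dir_deriv p (dir_deriv q f) z) < e/2" for p q
      using cont[of p q] S(2) \<open>e > 0\<close> unfolding continuous_on_iff by (metis half_gt_zero)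
    then obtain r1 r2 where r: "r1 > 0" "r2 > 0"
      "\<And>x. x \<in> S \<Longrightarrow> dist x z < r1 \<Longrightarrow>
        dist (dir_deriv v (dir_deriv w f) x) (dir_deriv v (dir_deriv w f) z) < e/2"
      "\<And>x. x \<in> S \<Longrightarrow> dist x z < r2 \<Longrightarrow>
        dist (dir_deriv w (dir_deriv v f) x) (dir_deriv w (dir_deriv v f) z) < e/2"
      by metis
    define r where "r = min r0 (min r1 r2)"
    have "r > 0" using r0 r by (simp add: r_def)
    \<comment> \<open>With this side length the whole parallelogram lies in the ball of radius \<open>r\<close> around \<open>z\<close>.\<close>
    define t where "t = r / (norm v + norm w + 1)"
    have t: "t > 0" unfolding t_def using \<open>r > 0\<close> by (intro divide_pos_pos) (auto intro: add_nonneg_pos)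
    have tr: "t * (norm v + norm w) < r"
    proof -
      have "t * (norm v + norm w + 1) = r"
        unfolding t_def by (simp add: add_nonneg_eq_0_iff)
      then show ?thesis using t by (simp add: algebra_simps)
    qed
    have near: "dist (z + a *\<^sub>R v + b *\<^sub>R w) z < r" if "0 \<le> a" "a \<le> t" "0 \<le> b" "b \<le> t" for a b
    proof -
      have "dist (z + a *\<^sub>R v + b *\<^sub>R w) z \<le> a * norm v + b * norm w"
        using that norm_triangle_ineq[of "a *\<^sub>R v" "b *\<^sub>R w"] by (simp add: dist_norm add.assoc)
      also have "\<dots> \<le> t * norm v + t * norm w"
        using that by (intro add_mono mult_right_mono) auto
      finally show ?thesis using tr by (simp add: algebra_simps)
    qed
    have inS: "z + a *\<^sub>R v + b *\<^sub>R w \<in> S" if "0 \<le> a" "a \<le> t" "0 \<le> b" "b \<le> t" for a b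
      using near[OF that] r0 by (auto simp: r_def dist_commute subset_iff)
    obtain \<xi> \<eta> where 1: "0 < \<xi>" "\<xi> < t" "0 < \<eta>" "\<eta> < t"
      "f (z + t *\<^sub>R v + t *\<^sub>R w) - f (z + t *\<^sub>R v) - f (z + t *\<^sub>R w) + f z
        = t * t * dir_deriv w (dir_deriv v f) (z + \<xi> *\<^sub>R v + \<eta> *\<^sub>R w)"
      using mvt[OF t inS] by blast
    have inS': "z + a *\<^sub>R w + b *\<^sub>R v \<in> S" if "0 \<le> a" "a \<le> t" "0 \<le> b" "b \<le> t" for a b
      using inS[of b a] that by (simp add: add_ac)
    obtain \<xi>' \<eta>' where 2: "0 < \<xi>'" "\<xi>' < t" "0 < \<eta>'" "\<eta>' < t"
      "f (z + t *\<^sub>R w + t *\<^sub>R v) - f (z + t *\<^sub>R w) - f (z + t *\<^sub>R v) + f z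
        = t * t * dir_deriv v (dir_deriv w f) (z + \<xi>' *\<^sub>R w + \<eta>' *\<^sub>R v)"
      using mvt[OF t inS'] by blast
    let ?p = "z + \<xi> *\<^sub>R v + \<eta> *\<^sub>R w" and ?q = "z + \<eta>' *\<^sub>R v + \<xi>' *\<^sub>R w"
    have qe: "z + \<xi>' *\<^sub>R w + \<eta>' *\<^sub>R v = ?q" "z + t *\<^sub>R w + t *\<^sub>R v = z + t *\<^sub>R v + t *\<^sub>R w"
      by (simp_all add: add_ac)
    have eq: "dir_deriv w (dir_deriv v f) ?p = dir_deriv v (dir_deriv w f) ?q"
      using 1(5) 2(5) t unfolding qe by (simp add: field_simps)
    have "dist (dir_deriv w (dir_deriv v f) ?p) (dir_deriv w (dir_deriv v f) z) < e/2"
      "dist (dir_deriv v (dir_deriv w f) ?q) (dir_deriv v (dir_deriv w f) z) < e/2"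
      using near[of \<xi> \<eta>] near[of \<eta>' \<xi>'] inS[of \<xi> \<eta>] inS[of \<eta>' \<xi>'] 1 2 r
      by (auto simp: r_def)
    with eq show ?thesis unfolding dist_real_def by linarith
  qed
  then have "\<bar>dir_deriv v (dir_deriv w f) z - dir_deriv w (dir_deriv v f) z\<bar> \<le> 0"
    by (rule field_le_epsilon[of _ 0, simplified])
  then show ?thesis by simp
qed

lemma dir_deriv_inner:
  assumes "f differentiable (at z)"
  shows "dir_deriv v (\<lambda>x. f x \<bullet> b) z = dir_deriv v f z \<bullet> b"
  by (rule dir_deriv_eq)
    (intro bounded_linear.has_derivative[OF bounded_linear_inner_left] has_derivative_dir_deriv assms)

lemma dir_deriv_commute:
  fixes f :: "'a::real_normed_vector \<Rightarrow> 'b::real_inner"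
  assumes S: "open S" "z \<in> S" and f: "smooth_on S f"
  shows "dir_deriv v (dir_deriv w f) z = dir_deriv w (dir_deriv v f) z"
proof -
  have "dir_deriv p (dir_deriv q f) z \<bullet> b = dir_deriv p (dir_deriv q (\<lambda>x. f x \<bullet> b)) z" for p q b
  proof -
    have d: "dir_deriv q f differentiable (at z)"
      using f S smooth_on_dir_deriv smooth_on_differentiable by blast
    have "dir_deriv p (dir_deriv q f) z \<bullet> b = dir_deriv p (\<lambda>x. dir_deriv q f x \<bullet> b) z"
      by (simp add: dir_deriv_inner d)
    also have "\<dots> = dir_deriv p (dir_deriv q (\<lambda>x. f x \<bullet> b)) z"
      by (rule dir_deriv_cong[OF S])
        (use f d in \<open>auto simp: dir_deriv_inner smooth_on_differentiable\<close>)
    finally show ?thesis .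
  qed
  moreover have "smooth_on S (\<lambda>x. f x \<bullet> b)" for b
    using f S(1) smooth_on_linear_image[OF S(1) bounded_linear_inner_left] by blast
  ultimately have "dir_deriv v (dir_deriv w f) z \<bullet> b = dir_deriv w (dir_deriv v f) z \<bullet> b" for b
    using dir_deriv_commute_real[OF S] by metis
  then show ?thesis by (metis vector_eq_rdot)
qed

lemma linear_euclidean_expansion:
  fixes L :: "'a::euclidean_space \<Rightarrow> 'b::real_vector"
  assumes "linear L"
  shows "L u = (\<Sum>b\<in>Basis. (u \<bullet> b) *\<^sub>R L b)"
  by (metis (no_types, lifting) assms euclidean_representation linear_cmul linear_sum sum.cong)

text \<open>The derivative of \<open>f\<close> along a moving vector at a moving point: the first summand comes from the
motion of the point, with the vector frozen, and the second one from the motion of the vector.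
Expanding the vector in a basis reduces this to the product rule.\<close>

lemma has_derivative_dir_deriv_along:
  fixes f :: "'a::euclidean_space \<Rightarrow> 'b::real_normed_vector"
  assumes S: "open S" and f: "smooth_on S f"
    and p: "(p has_derivative p') (at z)" "p z \<in> S"
    and V: "(V has_derivative V') (at z)"
  shows "((\<lambda>w. dir_deriv (V w) f (p w)) has_derivative
           (\<lambda>h. dir_deriv (p' h) (dir_deriv (V z) f) (p z) + dir_deriv (V' h) f (p z))) (at z)"
proof -
  have lin: "linear (\<lambda>v. dir_deriv v f x)" if "x \<in> S" for x
    using f that by (simp add: linear_dir_deriv smooth_on_differentiable)
  have db: "dir_deriv b f differentiable (at (p z))" for b
    using f p(2) by (meson smooth_on_dir_deriv smooth_on_differentiable)
  have ex: "dir_deriv v f x = (\<Sum>b\<in>Basis. (v \<bullet> b) *\<^sub>R dir_deriv b f x)" if "x \<in> S" for v x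
    using linear_euclidean_expansion[OF lin[OF that]] .
  have pb: "((\<lambda>w. dir_deriv b f (p w)) has_derivative (\<lambda>h. dir_deriv (p' h) (dir_deriv b f) (p z))) (at z)"
    for b
    using diff_chain_at[OF p(1) has_derivative_dir_deriv[OF db]] by (simp add: o_def)
  have d: "((\<lambda>w. \<Sum>b\<in>Basis. (V w \<bullet> b) *\<^sub>R dir_deriv b f (p w)) has_derivative
      (\<lambda>h. \<Sum>b\<in>Basis. (V z \<bullet> b) *\<^sub>R dir_deriv (p' h) (dir_deriv b f) (p z)
          + (V' h \<bullet> b) *\<^sub>R dir_deriv b f (p z))) (at z)"
    by (intro has_derivative_sum has_derivative_scaleR pb
        bounded_linear.has_derivative[OF bounded_linear_inner_left] V)
  have e1: "(\<Sum>b\<in>Basis. (V z \<bullet> b) *\<^sub>R dir_deriv k (dir_deriv b f) (p z))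
      = dir_deriv k (dir_deriv (V z) f) (p z)" for k
  proof -
    have "((\<lambda>x. \<Sum>b\<in>Basis. (V z \<bullet> b) *\<^sub>R dir_deriv b f x) has_derivative
        (\<lambda>k. \<Sum>b\<in>Basis. (V z \<bullet> b) *\<^sub>R dir_deriv k (dir_deriv b f) (p z))) (at (p z))"
      by (intro has_derivative_sum has_derivative_scaleR_right has_derivative_dir_deriv db)
    then have "(dir_deriv (V z) f has_derivative
        (\<lambda>k. \<Sum>b\<in>Basis. (V z \<bullet> b) *\<^sub>R dir_deriv k (dir_deriv b f) (p z))) (at (p z))"
      by (rule has_derivative_transform_within_open[OF _ S p(2)]) (simp add: ex[symmetric])
    from dir_deriv_eq[OF this] show ?thesis by simp
  qed
  have "isCont p z" using p(1) has_derivative_continuous by blast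
  then have "\<forall>\<^sub>F w in at z. p w \<in> S"
    using topological_tendstoD[of p "p z" "at z" S] S p(2) by (simp add: continuous_at)
  then have "\<forall>\<^sub>F w in at z. (\<Sum>b\<in>Basis. (V w \<bullet> b) *\<^sub>R dir_deriv b f (p w)) = dir_deriv (V w) f (p w)"
    by eventually_elim (rule ex[symmetric])
  then have "((\<lambda>w. dir_deriv (V w) f (p w)) has_derivative
      (\<lambda>h. \<Sum>b\<in>Basis. (V z \<bullet> b) *\<^sub>R dir_deriv (p' h) (dir_deriv b f) (p z)
          + (V' h \<bullet> b) *\<^sub>R dir_deriv b f (p z))) (at z)"
    by (rule has_derivative_transform_eventually[OF d]) (simp_all only: ex[OF p(2), of "V z"] UNIV_I)
  then show ?thesis
    unfolding sum.distrib e1 ex[OF p(2), symmetric] .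
qed

section \<open>The Euler-Lagrange expression in coordinates\<close>

text \<open>Points of the coordinate domain are pairs \<open>(x, y)\<close> of a position and a velocity. For
\<open>u = \<partial>/\<partial>x\<^sup>i\<close> this is the expression \<open>X(\<partial>f/\<partial>y\<^sup>i) - \<partial>f/\<partial>x\<^sup>i\<close>. A vector argument in place of
the index makes it possible to state changes of coordinates without components.\<close>

definition euler_lagrange ::
    "('e::euclidean_space \<times> 'e \<Rightarrow> real) \<Rightarrow> ('e \<times> 'e \<Rightarrow> 'e \<times> 'e) \<Rightarrow> 'e \<Rightarrow> 'e \<times> 'e \<Rightarrow> real" where
  "euler_lagrange f X u = (\<lambda>z. dir_deriv (X z) (dir_deriv (0, u) f) z - dir_deriv (u, 0) f z)"

lemma linear_euler_lagrange:
  assumes D: "open D" "z \<in> D" and f: "smooth_on D f"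
  shows "linear (\<lambda>u. euler_lagrange f X u z)"
proof -
  have eq: "euler_lagrange f X u z = dir_deriv (0, u) (dir_deriv (X z) f) z - dir_deriv (u, 0) f z" for u
    using dir_deriv_commute[OF D f] by (simp add: euler_lagrange_def)
  have "linear (\<lambda>v. dir_deriv v (dir_deriv (X z) f) z)" "linear (\<lambda>v. dir_deriv v f z)"
    using D f by (auto intro!: linear_dir_deriv intro: smooth_on_differentiable smooth_on_dir_deriv)
  moreover have "linear (\<lambda>u::'a. (0::'a, u))" "linear (\<lambda>u::'a. (u, 0::'a))"
    by (auto intro!: linearI)
  ultimately have "linear (\<lambda>u. dir_deriv (0, u) (dir_deriv (X z) f) z)" "linear (\<lambda>u. dir_deriv (u, 0) f z)"
    using linear_compose[unfolded o_def] by blast+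
  then show ?thesis unfolding eq by (rule linear_compose_sub)
qed

lemma smooth_on_euler_lagrange:
  assumes D: "open D" and f: "smooth_on D f" and X: "smooth_on D X"
  shows "smooth_on D (euler_lagrange f X u)"
proof -
  have Xb: "smooth_on D (\<lambda>z. X z \<bullet> b)" for b
    using smooth_on_linear_image[OF D bounded_linear_inner_left X] .
  have fu: "smooth_on D (dir_deriv b (dir_deriv (0, u) f))" "smooth_on D (dir_deriv (u, 0) f)" for b
    using f smooth_on_dir_deriv by blast+
  have "smooth_on D (\<lambda>z. (\<Sum>b\<in>Basis. (X z \<bullet> b) * dir_deriv b (dir_deriv (0, u) f) z)
      + (-1) * dir_deriv (u, 0) f z)"
    by (intro smooth_on_add smooth_on_sum smooth_on_mult smooth_on_const D Xb fu)
  then show ?thesis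
  proof (rule smooth_on_cong[OF _ D])
    fix z assume z: "z \<in> D"
    have "linear (\<lambda>v. dir_deriv v (dir_deriv (0, u) f) z)"
      by (intro linear_dir_deriv smooth_on_differentiable[OF smooth_on_dir_deriv[OF f] z])
    from linear_euclidean_expansion[OF this, of "X z"]
    show "(\<Sum>b\<in>Basis. (X z \<bullet> b) * dir_deriv b (dir_deriv (0, u) f) z)
      + (-1) * dir_deriv (u, 0) f z = euler_lagrange f X u z"
      by (simp add: euler_lagrange_def)
  qed
qed

lemma spray_has_derivative:
  fixes G :: "'e::euclidean_space \<times> 'e \<Rightarrow> 'e"
  assumes D: "open D" "z \<in> D" and G: "smooth_on D G"
    and X: "\<And>w. w \<in> D \<Longrightarrow> X w = (snd w, - 2 *\<^sub>R G w)"
  shows "(X has_derivative (\<lambda>h. (snd h, - 2 *\<^sub>R dir_deriv h G z))) (at z)"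
proof -
  have dG: "(G has_derivative (\<lambda>h. dir_deriv h G z)) (at z)"
    using G D(2) by (intro has_derivative_dir_deriv smooth_on_differentiable)
  have "((\<lambda>w. (snd w, - 2 *\<^sub>R G w)) has_derivative (\<lambda>h. (snd h, - 2 *\<^sub>R dir_deriv h G z))) (at z)"
    by (intro has_derivative_Pair has_derivative_snd has_derivative_ident
        has_derivative_scaleR_right dG)
  then show ?thesis
    by (rule has_derivative_transform_within_open[OF _ D]) (simp add: X)
qed

text \<open>Commuting the vertical derivative past the spray produces \<open>[(0, v), X] = (v, - 2 dG(0, v))\<close>, whose
horizontal part gives the first mixed term and whose vertical part gives the last term. The two
mixed \<open>x\<close>-\<open>y\<close> derivatives are exchanged when \<open>u\<close> and \<open>v\<close> are.\<close>

lemma vertical_deriv_euler_lagrange: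
  fixes G :: "'e::euclidean_space \<times> 'e \<Rightarrow> 'e"
  assumes D: "open D" "z \<in> D" and f: "smooth_on D f" and G: "smooth_on D G"
    and X: "\<And>w. w \<in> D \<Longrightarrow> X w = (snd w, - 2 *\<^sub>R G w)"
  shows "dir_deriv (0, v) (euler_lagrange f X u) z =
    dir_deriv (X z) (dir_deriv (0, v) (dir_deriv (0, u) f)) z
    + dir_deriv (v, 0) (dir_deriv (0, u) f) z - dir_deriv (u, 0) (dir_deriv (0, v) f) z
    - 2 * dir_deriv (0, dir_deriv (0, v) G z) (dir_deriv (0, u) f) z"
proof -
  let ?fu = "dir_deriv (0, u) f"
  have fu: "smooth_on D ?fu" and fx: "smooth_on D (dir_deriv (u, 0) f)"
    using f smooth_on_dir_deriv by blast+
  have "(euler_lagrange f X u has_derivative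
      (\<lambda>h. (dir_deriv h (dir_deriv (X z) ?fu) z + dir_deriv (snd h, - 2 *\<^sub>R dir_deriv h G z) ?fu z)
        - dir_deriv h (dir_deriv (u, 0) f) z)) (at z)"
    unfolding euler_lagrange_def
    by (intro has_derivative_diff has_derivative_dir_deriv smooth_on_differentiable[OF fx D(2)]
        has_derivative_dir_deriv_along[OF D(1) fu has_derivative_ident D(2)]
        spray_has_derivative[OF D G X])
  from dir_deriv_eq[OF this, of "(0, v)"]
  have "dir_deriv (0, v) (euler_lagrange f X u) z =
      dir_deriv (0, v) (dir_deriv (X z) ?fu) z + dir_deriv (v, - 2 *\<^sub>R dir_deriv (0, v) G z) ?fu z
        - dir_deriv (0, v) (dir_deriv (u, 0) f) z"
    by simp
  moreover have "dir_deriv (0, v) (dir_deriv (X z) ?fu) z = dir_deriv (X z) (dir_deriv (0, v) ?fu) z"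
    "dir_deriv (0, v) (dir_deriv (u, 0) f) z = dir_deriv (u, 0) (dir_deriv (0, v) f) z"
    using dir_deriv_commute[OF D fu] dir_deriv_commute[OF D f] by blast+
  moreover have "dir_deriv (v, - 2 *\<^sub>R dir_deriv (0, v) G z) ?fu z
      = dir_deriv (v, 0) ?fu z - 2 * dir_deriv (0, dir_deriv (0, v) G z) ?fu z"
  proof -
    have lin: "linear (\<lambda>h. dir_deriv h ?fu z)"
      using smooth_on_differentiable[OF fu D(2)] by (rule linear_dir_deriv)
    have "(v, - 2 *\<^sub>R dir_deriv (0, v) G z) = (v, 0) + (- 2) *\<^sub>R (0, dir_deriv (0, v) G z)"
      by simp
    then show ?thesis
      using linear_add[OF lin, of "(v, 0)" "(- 2) *\<^sub>R (0, dir_deriv (0, v) G z)"]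
        linear_cmul[OF lin, of "- 2" "(0, dir_deriv (0, v) G z)"] by (simp del: scaleR_Pair)
  qed
  ultimately show ?thesis by simp
qed

text \<open>The mixed \<open>x\<close>-\<open>y\<close> derivatives cancel in the symmetrization. What remains is twice the dynamical
covariant derivative of the fibre Hessian of \<open>f\<close>, written without components.\<close>

lemma vertical_deriv_euler_lagrange_sym:
  fixes G :: "'e::euclidean_space \<times> 'e \<Rightarrow> 'e"
  assumes D: "open D" "z \<in> D" and f: "smooth_on D f" and G: "smooth_on D G"
    and X: "\<And>w. w \<in> D \<Longrightarrow> X w = (snd w, - 2 *\<^sub>R G w)"
  shows "dir_deriv (0, v) (euler_lagrange f X u) z + dir_deriv (0, u) (euler_lagrange f X v) z =
    2 * (dir_deriv (X z) (dir_deriv (0, v) (dir_deriv (0, u) f)) z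
      - dir_deriv (0, dir_deriv (0, v) G z) (dir_deriv (0, u) f) z
      - dir_deriv (0, dir_deriv (0, u) G z) (dir_deriv (0, v) f) z)"
proof -
  have "dir_deriv (X z) (dir_deriv (0, u) (dir_deriv (0, v) f)) z
      = dir_deriv (X z) (dir_deriv (0, v) (dir_deriv (0, u) f)) z"
  proof (rule dir_deriv_cong[OF D])
    show "dir_deriv (0, u) (dir_deriv (0, v) f) w = dir_deriv (0, v) (dir_deriv (0, u) f) w"
      if "w \<in> D" for w using dir_deriv_commute[OF D(1) that f] .
    show "dir_deriv (0, u) (dir_deriv (0, v) f) differentiable at z"
      using D f by (meson smooth_on_differentiable smooth_on_dir_deriv)
  qed
  then show ?thesis
    using vertical_deriv_euler_lagrange[OF assms, of v u] vertical_deriv_euler_lagrange[OF assms, of u v]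
    by simp
qed

text \<open>Differentiate \<open>f (x, t y) = s f (x, y)\<close>. The factor \<open>s\<close> is left general because the lemma is used with
\<open>s = t\<close> for a Finsler function and with \<open>s = 1\<close> for its fibre derivatives.\<close>

lemma dir_deriv_homogeneous:
  fixes f :: "'e::euclidean_space \<times> 'e \<Rightarrow> real"
  assumes D: "open D" "(x, y) \<in> D" and t: "(x, t *\<^sub>R y) \<in> D"
    and f: "smooth_on D f"
    and hom: "\<And>x y. (x, y) \<in> D \<Longrightarrow> f (x, t *\<^sub>R y) = s * f (x, y)"
  shows "dir_deriv (a, t *\<^sub>R b) f (x, t *\<^sub>R y) = s * dir_deriv (a, b) f (x, y)"
proof -
  let ?L = "\<lambda>z::'e \<times> 'e. (fst z, t *\<^sub>R snd z)"
  have L: "bounded_linear ?L"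
    by (intro bounded_linear_Pair bounded_linear_fst bounded_linear_snd bounded_linear_const_scaleR)
  have "((\<lambda>z. f (?L z + 0)) has_derivative (\<lambda>h. dir_deriv (?L h) f (?L (x, y) + 0))) (at (x, y))"
    by (rule has_derivative_compose_affine[OF L]) (use smooth_on_differentiable[OF f t] in simp)
  then have 1: "((\<lambda>z. f (fst z, t *\<^sub>R snd z)) has_derivative (\<lambda>h. dir_deriv (?L h) f (x, t *\<^sub>R y))) (at (x, y))"
    by simp
  have "((\<lambda>z. s * f z) has_derivative (\<lambda>h. dir_deriv (?L h) f (x, t *\<^sub>R y))) (at (x, y))"
    by (rule has_derivative_transform_within_open[OF 1 D]) (simp add: hom)
  moreover have "((\<lambda>z. s * f z) has_derivative (\<lambda>h. s * dir_deriv h f (x, y))) (at (x, y))"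
    by (intro has_derivative_mult_right has_derivative_dir_deriv smooth_on_differentiable[OF f D(2)])
  ultimately have "(\<lambda>h. dir_deriv (?L h) f (x, t *\<^sub>R y)) = (\<lambda>h. s * dir_deriv h f (x, y))"
    by (rule has_derivative_unique)
  then show ?thesis by (auto simp: fun_eq_iff)
qed

text \<open>The fibre derivatives of \<open>f\<close> are homogeneous of degree 0, and the spray raises the degree by one:
its value at \<open>(x, t y)\<close> is \<open>t\<close> times the image of its value at \<open>(x, y)\<close> under the differential of
\<open>(x, y) \<mapsto> (x, t y)\<close>.\<close>

lemma euler_lagrange_homogeneous:
  fixes G :: "'e::euclidean_space \<times> 'e \<Rightarrow> 'e"
  assumes D: "open D" "(x, y) \<in> D" and t: "t > 0"
    and cone: "\<And>x y. (x, y) \<in> D \<Longrightarrow> (x, t *\<^sub>R y) \<in> D"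
    and f: "smooth_on D f" and X: "\<And>w. w \<in> D \<Longrightarrow> X w = (snd w, - 2 *\<^sub>R G w)"
    and homf: "\<And>x y. (x, y) \<in> D \<Longrightarrow> f (x, t *\<^sub>R y) = t * f (x, y)"
    and homG: "\<And>x y. (x, y) \<in> D \<Longrightarrow> G (x, t *\<^sub>R y) = t\<^sup>2 *\<^sub>R G (x, y)"
  shows "euler_lagrange f X u (x, t *\<^sub>R y) = t * euler_lagrange f X u (x, y)"
proof -
  let ?fu = "dir_deriv (0, u) f"
  have fu: "smooth_on D ?fu" using f by (rule smooth_on_dir_deriv)
  have ty: "(x, t *\<^sub>R y) \<in> D" using cone D by blast
  have homfu: "?fu (x, t *\<^sub>R y) = 1 * ?fu (x, y)" if "(x, y) \<in> D" for x y
  proof -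
    have "t * ?fu (x, t *\<^sub>R y) = dir_deriv (0, t *\<^sub>R u) f (x, t *\<^sub>R y)"
      using linear_cmul[OF linear_dir_deriv[OF smooth_on_differentiable[OF f cone[OF that]]], of t "(0, u)"]
      by simp
    also have "\<dots> = t * ?fu (x, y)"
      by (rule dir_deriv_homogeneous[OF D(1) that cone[OF that] f homf])
    finally show ?thesis using t by simp
  qed
  have "X (x, t *\<^sub>R y) = (t *\<^sub>R y, t *\<^sub>R (t *\<^sub>R (- 2 *\<^sub>R G (x, y))))"
    by (simp add: X ty homG D power2_eq_square)
  then have "dir_deriv (X (x, t *\<^sub>R y)) ?fu (x, t *\<^sub>R y)
      = 1 * dir_deriv (t *\<^sub>R y, t *\<^sub>R (- 2 *\<^sub>R G (x, y))) ?fu (x, y)"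
    using dir_deriv_homogeneous[OF D ty fu homfu, of "t *\<^sub>R y" "t *\<^sub>R (- 2 *\<^sub>R G (x, y))"]
    by (simp only:)
  also have "(t *\<^sub>R y, t *\<^sub>R (- 2 *\<^sub>R G (x, y))) = t *\<^sub>R X (x, y)"
    by (simp add: X D)
  also have "1 * dir_deriv (t *\<^sub>R X (x, y)) ?fu (x, y) = t * dir_deriv (X (x, y)) ?fu (x, y)"
    using linear_cmul[OF linear_dir_deriv[OF smooth_on_differentiable[OF fu D(2)]]] by simp
  finally show ?thesis
    using dir_deriv_homogeneous[OF D ty f homf, of u 0]
    by (simp add: euler_lagrange_def right_diff_distrib)
qed

section \<open>Maps with skew derivative on a punctured vector space\<close>

text \<open>The second derivative \<open>T(u, v, w)\<close> of \<open>L u\<close> along \<open>v\<close> and \<open>w\<close> is symmetric in its last two arguments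
and skew in its first two, and such a trilinear expression vanishes; this is the argument that
makes Killing fields of a flat space affine. So the first derivatives are locally constant, and
constant when the punctured space is connected. In dimension one the punctured space is not
connected, but there a skew bilinear expression is zero.\<close>

lemma dir_deriv_skew_constant:
  fixes L :: "'e::euclidean_space \<Rightarrow> 'e \<Rightarrow> real"
  assumes smooth: "\<And>u. smooth_on (- {0}) (L u)"
    and skew: "\<And>u v y. y \<noteq> 0 \<Longrightarrow> dir_deriv v (L u) y = - dir_deriv u (L v) y"
    and "y \<noteq> 0" "y' \<noteq> 0"
  shows "dir_deriv v (L u) y = dir_deriv v (L u) y'"
proof (cases "2 \<le> DIM('e)")
  case True
  have o: "open (- {0::'e})" by (intro open_Compl closed_singleton)
  have sm1: "smooth_on (- {0}) (dir_deriv v (L u))" for u v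
    using smooth by (rule smooth_on_dir_deriv)
  have zero: "dir_deriv w (dir_deriv v (L u)) z = 0" if "z \<noteq> 0" for u v w z
  proof -
    have z: "z \<in> - {0}" using that by simp
    have sym: "dir_deriv w (dir_deriv v (L u)) z = dir_deriv v (dir_deriv w (L u)) z" for u v w
      by (rule dir_deriv_commute[OF o z smooth])
    have anti: "dir_deriv w (dir_deriv v (L u)) z = - dir_deriv w (dir_deriv u (L v)) z" for u v w
    proof -
      have "dir_deriv w (dir_deriv v (L u)) z = dir_deriv w (\<lambda>y. - dir_deriv u (L v) y) z"
        by (rule dir_deriv_cong[OF o z _ smooth_on_differentiable[OF sm1 z]]) (rule skew, simp)
      also have "\<dots> = - dir_deriv w (dir_deriv u (L v)) z"
        by (intro dir_deriv_eq has_derivative_minus has_derivative_dir_deriv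
            smooth_on_differentiable[OF sm1 z])
      finally show ?thesis .
    qed
    show ?thesis
      \<comment> \<open>Six alternating exchanges bring the three arguments back with the opposite sign.\<close>
      using anti[of w v u] sym[of u w v] anti[of u w v] sym[of u v w] anti[of v u w] sym[of v w u]
      by linarith
  qed
  have const: "(dir_deriv v (L u) has_derivative (\<lambda>_. 0)) (at z)" if "z \<in> - {0}" for z
    using has_derivative_dir_deriv[OF smooth_on_differentiable[OF sm1[of v u] that]] zero[of z] that
    by simp
  show ?thesis
    by (rule has_derivative_zero_unique_connected[OF o connected_punctured_universe[OF True] const])
      (use assms(3,4) in simp_all)
next
  case False
  then have "DIM('e) = 1" using DIM_positive[where 'a='e] by linarith
  then obtain b :: 'e where b: "Basis = {b}" using card_1_singletonE by blast
  have "dir_deriv v (L u) z = 0" if "z \<noteq> 0" for z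
  proof -
    have lin: "linear (\<lambda>v. dir_deriv v (L u) z)" for u
      using smooth_on_differentiable[OF smooth] that by (intro linear_dir_deriv) auto
    have ex: "dir_deriv v (L u) z = (v \<bullet> b) * dir_deriv b (L u) z" for u v
      using linear_euclidean_expansion[OF lin, of v u] by (simp add: b)
    have "dir_deriv v (L u) z = (v \<bullet> b) * - ((u \<bullet> b) * dir_deriv b (L b) z)"
      unfolding ex[of v u] skew[OF that, of b u] ex[of u b] ..
    moreover have "dir_deriv b (L b) z = 0" using skew[OF that, of b b] by simp
    ultimately show ?thesis by simp
  qed
  then show ?thesis using assms(3,4) by simp
qed

lemma euler_homogeneous:
  fixes g :: "'e::real_normed_vector \<Rightarrow> real"
  assumes "g differentiable (at y)" and hom: "\<And>t. t > 0 \<Longrightarrow> g (t *\<^sub>R y) = t * g y"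
  shows "dir_deriv y g y = g y"
proof -
  \<comment> \<open>Differentiate \<open>g (s y) = s g y\<close> at \<open>s = 1\<close>.\<close>
  have "((\<lambda>s. g (0 + s *\<^sub>R y)) has_real_derivative dir_deriv y g (0 + 1 *\<^sub>R y)) (at 1)"
    by (rule has_real_derivative_along_line) (use assms in simp)
  then have 1: "((\<lambda>s. g (s *\<^sub>R y)) has_real_derivative dir_deriv y g y) (at 1)"
    by simp
  have "((\<lambda>s. s * g y) has_real_derivative dir_deriv y g y) (at 1)"
    by (rule has_field_derivative_transform_within_open[OF 1, of "{0<..}"]) (simp_all add: hom)
  moreover have "((\<lambda>s. s * g y) has_real_derivative g y) (at 1)"
    by (auto intro!: derivative_eq_intros)
  ultimately show ?thesis by (rule DERIV_unique)
qed

text \<open>Euler's identity turns \<open>L u v\<close> into a derivative at the point \<open>v\<close>, constancy moves it to the point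
\<open>u\<close>, where it can be exchanged for a derivative of \<open>L v\<close>, and Euler's identity turns that back into
a value.\<close>

lemma skew_of_dir_deriv_skew:
  fixes L :: "'e::euclidean_space \<Rightarrow> 'e \<Rightarrow> real"
  assumes smooth: "\<And>u. smooth_on (- {0}) (L u)"
    and skew: "\<And>u v y. y \<noteq> 0 \<Longrightarrow> dir_deriv v (L u) y = - dir_deriv u (L v) y"
    and hom: "\<And>u y t. \<lbrakk>y \<noteq> 0; t > 0\<rbrakk> \<Longrightarrow> L u (t *\<^sub>R y) = t * L u y"
    and uv: "u \<noteq> 0" "v \<noteq> 0"
  shows "L u v = - L v u"
proof -
  have eu: "dir_deriv y (L w) y = L w y" if "y \<noteq> 0" for w y
    using smooth_on_differentiable[OF smooth, of y w] that hom by (intro euler_homogeneous) auto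
  have "L u v = dir_deriv v (L u) v" using eu uv by simp
  also have "\<dots> = dir_deriv v (L u) u"
    by (rule dir_deriv_skew_constant[OF smooth skew uv(2,1)])
  also have "\<dots> = - dir_deriv u (L v) u" using skew uv by blast
  finally show ?thesis using eu uv by simp
qed

section \<open>Changes of coordinates\<close>

definition tangent_map :: "('e::real_normed_vector \<Rightarrow> 'e) \<Rightarrow> 'e \<times> 'e \<Rightarrow> 'e \<times> 'e" where
  "tangent_map \<phi> = (\<lambda>(x, y). (\<phi> x, dir_deriv y \<phi> x))"

lemma has_derivative_tangent_map:
  fixes \<phi> :: "'e::euclidean_space \<Rightarrow> 'e"
  assumes U: "open U" "fst z \<in> U" and \<phi>: "smooth_on U \<phi>"
  shows "(tangent_map \<phi> has_derivative (\<lambda>h. (dir_deriv (fst h) \<phi> (fst z),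
    dir_deriv (fst h) (dir_deriv (snd z) \<phi>) (fst z) + dir_deriv (snd h) \<phi> (fst z)))) (at z)"
proof -
  have "((\<lambda>w. \<phi> (fst w)) has_derivative (\<lambda>h. dir_deriv (fst h) \<phi> (fst z))) (at z)"
    using diff_chain_at[OF has_derivative_fst[OF has_derivative_ident]
        has_derivative_dir_deriv[OF smooth_on_differentiable[OF \<phi> U(2)]]] by (simp add: o_def)
  moreover have "((\<lambda>w. dir_deriv (snd w) \<phi> (fst w)) has_derivative
      (\<lambda>h. dir_deriv (fst h) (dir_deriv (snd z) \<phi>) (fst z) + dir_deriv (snd h) \<phi> (fst z))) (at z)"
    by (rule has_derivative_dir_deriv_along[OF U(1) \<phi>, where p = fst and V = snd])
      (use U(2) in \<open>auto intro!: derivative_eq_intros\<close>)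
  ultimately show ?thesis
    unfolding tangent_map_def case_prod_beta by (rule has_derivative_Pair)
qed

text \<open>The Euler-Lagrange expression is a covector. Two terms with second derivatives of the coordinate
change appear, one from the derivative of \<open>d\<phi>(u)\<close> along the velocity and one from the derivative of
\<open>d\<phi>(y)\<close> along \<open>u\<close>. They cancel by the symmetry of second derivatives, and this uses that the
horizontal part of \<open>X\<close> at \<open>(x, y)\<close> is \<open>y\<close>.\<close>

lemma euler_lagrange_tangent_map:
  fixes \<phi> :: "'e::euclidean_space \<Rightarrow> 'e"
  assumes U: "open U" and \<phi>: "smooth_on U \<phi>"
    and W: "open W" "\<And>w. w \<in> W \<Longrightarrow> fst w \<in> U" "z \<in> W"
    and D: "open D" "\<And>w. w \<in> W \<Longrightarrow> tangent_map \<phi> w \<in> D" and f: "smooth_on D f"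
    and g: "\<And>w. w \<in> W \<Longrightarrow> g w = f (tangent_map \<phi> w)"
    and X: "fst (X z) = snd z" and Y: "Y (tangent_map \<phi> z) = dir_deriv (X z) (tangent_map \<phi>) z"
  shows "euler_lagrange g X u z = euler_lagrange f Y (dir_deriv u \<phi> (fst z)) (tangent_map \<phi> z)"
proof -
  let ?T = "tangent_map \<phi>" and ?x = "fst z" and ?y = "snd z"
  define T' where "T' w h = (dir_deriv (fst h) \<phi> (fst w),
    dir_deriv (fst h) (dir_deriv (snd w) \<phi>) (fst w) + dir_deriv (snd h) \<phi> (fst w))" for w h
  have T': "(?T has_derivative T' w) (at w)" if "w \<in> W" for w
    unfolding T'_def[abs_def] by (rule has_derivative_tangent_map[OF U W(2)[OF that] \<phi>])
  have dg: "(g has_derivative (\<lambda>h. dir_deriv (T' w h) f (?T w))) (at w)" if w: "w \<in> W" for w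
  proof -
    have "((\<lambda>w. f (?T w)) has_derivative (\<lambda>h. dir_deriv (T' w h) f (?T w))) (at w)"
      using diff_chain_at[OF T'[OF w] has_derivative_dir_deriv[OF smooth_on_differentiable[OF f D(2)[OF w]]]]
      by (simp add: o_def)
    then show ?thesis
      by (rule has_derivative_transform_within_open[OF _ W(1) w]) (simp add: g)
  qed
  have lin\<phi>: "linear (\<lambda>h. dir_deriv h \<phi> (fst w))" "linear (\<lambda>h. dir_deriv h (dir_deriv a \<phi>) (fst w))"
    if "w \<in> W" for a w
    by (intro linear_dir_deriv smooth_on_differentiable[OF _ W(2)[OF that]] smooth_on_dir_deriv \<phi>)+
  \<comment> \<open>By the chain rule, differentiating \<open>g\<close> along \<open>(0, u)\<close> is differentiating \<open>f\<close> along \<open>V\<close>.\<close>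
  define V where "V w = (0 :: 'e, dir_deriv u \<phi> (fst w))" for w :: "'e \<times> 'e"
  have gu: "dir_deriv (V w) f (?T w) = dir_deriv (0, u) g w" if w: "w \<in> W" for w
    using dir_deriv_eq[OF dg[OF w], of "(0, u)"] linear_0[OF lin\<phi>(1)[OF w]] linear_0[OF lin\<phi>(2)[OF w]]
    by (simp add: T'_def V_def)
  have V': "(V has_derivative (\<lambda>h. (0, dir_deriv (fst h) (dir_deriv u \<phi>) ?x))) (at z)"
    unfolding V_def[abs_def]
    using diff_chain_at[OF has_derivative_fst[OF has_derivative_ident] has_derivative_dir_deriv
          [OF smooth_on_differentiable[OF smooth_on_dir_deriv[OF \<phi>] W(2)[OF W(3)]]]]
    by (intro has_derivative_Pair has_derivative_const) (simp add: o_def)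
  have "(dir_deriv (0, u) g has_derivative (\<lambda>h. dir_deriv (T' z h) (dir_deriv (V z) f) (?T z)
      + dir_deriv (0, dir_deriv (fst h) (dir_deriv u \<phi>) ?x) f (?T z))) (at z)"
    by (rule has_derivative_transform_within_open[OF has_derivative_dir_deriv_along
          [OF D(1) f T'[OF W(3)] D(2)[OF W(3)] V'] W(1,3) gu])
  from dir_deriv_eq[OF this, of "X z"]
  have 1: "dir_deriv (X z) (dir_deriv (0, u) g) z = dir_deriv (T' z (X z)) (dir_deriv (V z) f) (?T z)
      + dir_deriv (0, dir_deriv ?y (dir_deriv u \<phi>) ?x) f (?T z)"
    by (simp add: X)
  have Yz: "T' z (X z) = Y (?T z)"
    by (simp add: Y dir_deriv_eq[OF T'[OF W(3)]])
  have linf: "linear (\<lambda>h. dir_deriv h f (?T z))"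
    using linear_dir_deriv smooth_on_differentiable[OF f D(2)[OF W(3)]] by blast
  have "dir_deriv (u, 0) g z = dir_deriv (dir_deriv u \<phi> ?x, dir_deriv u (dir_deriv ?y \<phi>) ?x) f (?T z)"
    using dir_deriv_eq[OF dg[OF W(3)], of "(u, 0)"] linear_0[OF lin\<phi>(1)[OF W(3)]]
    by (simp add: T'_def)
  also have "\<dots> = dir_deriv (dir_deriv u \<phi> ?x, 0) f (?T z)
      + dir_deriv (0, dir_deriv u (dir_deriv ?y \<phi>) ?x) f (?T z)"
    using linear_add[OF linf, of "(dir_deriv u \<phi> ?x, 0)" "(0, dir_deriv u (dir_deriv ?y \<phi>) ?x)"] by simp
  also have "dir_deriv u (dir_deriv ?y \<phi>) ?x = dir_deriv ?y (dir_deriv u \<phi>) ?x"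
    by (rule dir_deriv_commute[OF U W(2)[OF W(3)] \<phi>])
  finally show ?thesis
    unfolding euler_lagrange_def 1 Yz by (simp add: V_def)
qed

section \<open>Charts of the slit tangent bundle\<close>

lemma chart_inv_left: "\<lbrakk>smooth_atlas A; c \<in> A; p \<in> fst c\<rbrakk> \<Longrightarrow> chart_inv c (snd c p) = p"
  unfolding smooth_atlas_def by (blast intro: homeomorphism_apply1)

lemma chart_image_iff: "x \<in> chart_image c \<longleftrightarrow> (\<exists>p\<in>fst c. x = snd c p)"
  by (auto simp: chart_image_def)

lemma chart_image_inv:
  assumes "smooth_atlas A" "c \<in> A" "x \<in> chart_image c"
  shows "chart_inv c x \<in> fst c" "snd c (chart_inv c x) = x"
  using assms chart_inv_left[OF assms(1,2)] by (auto simp: chart_image_iff)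

lemma open_chart_image: "\<lbrakk>smooth_atlas A; c \<in> A\<rbrakk> \<Longrightarrow> open (chart_image c)"
  by (simp add: smooth_atlas_def)

lemma open_chart_overlap:
  assumes A: "smooth_atlas A" "c \<in> A" "d \<in> A"
  shows "open (snd c ` (fst c \<inter> fst d))"
proof -
  have h: "homeomorphism (fst c) (chart_image c) (snd c) (chart_inv c)"
    and "open (fst d)" "open (chart_image c)"
    using A by (auto simp: smooth_atlas_def)
  then have "openin (top_of_set (chart_image c)) (snd c ` (fst c \<inter> fst d))"
    by (intro homeomorphism_imp_open_map[OF h] openin_open_Int)
  then show ?thesis using \<open>open (chart_image c)\<close> openin_open_trans by blast
qed

lemma transition_apply:
  "\<lbrakk>smooth_atlas A; c \<in> A; p \<in> fst c\<rbrakk> \<Longrightarrow> transition c d (snd c p) = snd d p"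
  by (simp add: transition_def chart_inv_left)

lemma smooth_transition:
  "\<lbrakk>smooth_atlas A; c \<in> A; d \<in> A\<rbrakk> \<Longrightarrow> smooth_on (snd c ` (fst c \<inter> fst d)) (transition c d)"
  by (simp add: smooth_atlas_def)

lemma transition_differentiable:
  "\<lbrakk>smooth_atlas A; c \<in> A; d \<in> A; p \<in> fst c; p \<in> fst d\<rbrakk>
    \<Longrightarrow> transition c d differentiable (at (snd c p))"
  by (rule smooth_on_differentiable[OF smooth_transition]) auto

lemma dir_deriv_transition_self:
  assumes A: "smooth_atlas A" "c \<in> A" "p \<in> fst c"
  shows "dir_deriv w (transition c c) (snd c p) = w"
proof (rule dir_deriv_eq)
  show "(transition c c has_derivative (\<lambda>w. w)) (at (snd c p))"
  proof (rule has_derivative_transform_within_open[OF has_derivative_ident open_chart_image[OF A(1,2)]])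
    show "snd c p \<in> chart_image c" using A(3) by (auto simp: chart_image_def)
    fix x assume "x \<in> chart_image c"
    then obtain q where "q \<in> fst c" "x = snd c q" unfolding chart_image_iff by blast
    then show "x = transition c c x" by (simp add: transition_apply[OF A(1,2)])
  qed
qed

text \<open>The cocycle property of the differentials of the transition maps; it makes the components of
\<^const>\<open>coord_vector\<close> in different charts compatible.\<close>

lemma dir_deriv_transition_trans:
  assumes A: "smooth_atlas A" "c \<in> A" "d \<in> A" "e \<in> A" and p: "p \<in> fst c" "p \<in> fst d" "p \<in> fst e"
  shows "dir_deriv w (transition c e) (snd c p)
    = dir_deriv (dir_deriv w (transition c d) (snd c p)) (transition d e) (snd d p)"
proof (rule dir_deriv_eq)
  let ?O = "snd c ` (fst c \<inter> fst d)"
  have o: "open ?O" using A by (intro open_chart_overlap)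
  have "((\<lambda>x. transition d e (transition c d x)) has_derivative
      (\<lambda>w. dir_deriv (dir_deriv w (transition c d) (snd c p)) (transition d e) (snd d p))) (at (snd c p))"
    using diff_chain_at[OF has_derivative_dir_deriv[OF transition_differentiable[OF A(1-3) p(1,2)]]
        has_derivative_dir_deriv[of "transition d e" "transition c d (snd c p)"]]
      transition_differentiable[OF A(1,3,4) p(2,3)]
    by (simp add: o_def transition_apply[OF A(1,2) p(1)])
  then show "(transition c e has_derivative
      (\<lambda>w. dir_deriv (dir_deriv w (transition c d) (snd c p)) (transition d e) (snd d p))) (at (snd c p))"
  proof (rule has_derivative_transform_within_open[OF _ o])
    show "snd c p \<in> ?O" using p by blast
    fix x assume "x \<in> ?O"
    then obtain q where "q \<in> fst c" "q \<in> fst d" "x = snd c q" by blast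
    then show "transition d e (transition c d x) = transition c e x"
      by (simp add: transition_apply[OF A(1,2)] transition_apply[OF A(1,3)])
  qed
qed

lemma coord_vector_apply:
  "\<lbrakk>d \<in> A; p \<in> fst d\<rbrakk> \<Longrightarrow> coord_vector A c p w d = dir_deriv w (transition c d) (snd c p)"
  by (simp add: coord_vector_def dir_deriv_def)

lemma coord_vector_self:
  "\<lbrakk>smooth_atlas A; c \<in> A; p \<in> fst c\<rbrakk> \<Longrightarrow> coord_vector A c p w c = w"
  by (simp add: coord_vector_apply dir_deriv_transition_self)

lemma coord_vector_tangent:
  assumes A: "smooth_atlas A" "c \<in> A" "p \<in> fst c"
  shows "coord_vector A c p w \<in> tangent_space A p"
proof -
  have "coord_vector A c p w e = dir_deriv (coord_vector A c p w d) (transition d e) (snd d p)"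
    if "d \<in> A" "e \<in> A" "p \<in> fst d" "p \<in> fst e" for d e
    using dir_deriv_transition_trans[OF A(1,2) that(1,2) A(3) that(3,4), of w] that
    by (simp add: coord_vector_apply)
  moreover have "coord_vector A c p w e = 0" if "\<not> (e \<in> A \<and> p \<in> fst e)" for e
    using that by (auto simp: coord_vector_def)
  ultimately show ?thesis unfolding tangent_space_def dir_deriv_def by blast
qed

lemma tangent_space_change:
  "\<lbrakk>v \<in> tangent_space A p; c \<in> A; d \<in> A; p \<in> fst c; p \<in> fst d\<rbrakk>
    \<Longrightarrow> v d = dir_deriv (v c) (transition c d) (snd c p)"
  unfolding tangent_space_def dir_deriv_def by blast

lemma tangent_space_outside:
  "\<lbrakk>v \<in> tangent_space A p; \<not> (c \<in> A \<and> p \<in> fst c)\<rbrakk> \<Longrightarrow> v c = 0"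
  unfolding tangent_space_def by blast

lemma coord_vector_eq:
  assumes "v \<in> tangent_space A p" "c \<in> A" "p \<in> fst c"
  shows "coord_vector A c p (v c) = v"
proof
  fix d show "coord_vector A c p (v c) d = v d"
    using tangent_space_change[OF assms(1,2) _ assms(3), of d] tangent_space_outside[OF assms(1), of d]
    by (cases "d \<in> A \<and> p \<in> fst d") (auto simp: coord_vector_def dir_deriv_def)
qed

lemma coord_vector_zero:
  assumes A: "smooth_atlas A" "c \<in> A" "p \<in> fst c"
  shows "coord_vector A c p 0 = (\<lambda>_. 0)"
  using linear_0[OF linear_dir_deriv[OF transition_differentiable[OF A(1,2) _ A(3)]]]
  by (auto simp: coord_vector_def fun_eq_iff dir_deriv_def)

lemma tangent_component_zero_iff:
  assumes "smooth_atlas A" "v \<in> tangent_space A p" "c \<in> A" "p \<in> fst c"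
  shows "v c = 0 \<longleftrightarrow> v = (\<lambda>_. 0)"
  using coord_vector_eq[OF assms(2-4)] coord_vector_zero[OF assms(1,3,4)] by auto

lemma coord_vector_slit:
  fixes A :: "('m::topological_space, real^'n) chart set"
  assumes A: "smooth_atlas A" "c \<in> A" "p \<in> fst c" and "w \<noteq> 0"
  shows "(p, coord_vector A c p w) \<in> slit_bundle A"
  using coord_vector_tangent[OF A] coord_vector_self[OF A, of w] \<open>w \<noteq> 0\<close>
  by (auto simp: slit_bundle_def)

lemma slit_chart_image:
  fixes A :: "('m::topological_space, real^'n) chart set"
  assumes A: "smooth_atlas A" "c \<in> A"
  shows "chart_image (slit_chart A c) = chart_image c \<times> (- {0})"
proof (intro set_eqI iffI)
  fix z assume "z \<in> chart_image (slit_chart A c)"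
  then obtain p v where "(p, v) \<in> slit_bundle A" "p \<in> fst c" "z = (snd c p, v c)"
    by (auto simp: chart_image_def slit_chart_def)
  then show "z \<in> chart_image c \<times> (- {0})"
    using tangent_component_zero_iff[OF A(1) _ A(2), of v p]
    by (auto simp: slit_bundle_def chart_image_def)
next
  fix z :: "(real^'n) \<times> (real^'n)" assume "z \<in> chart_image c \<times> (- {0})"
  then obtain p where p: "p \<in> fst c" "fst z = snd c p" "snd z \<noteq> 0"
    by (cases z) (auto simp: chart_image_def)
  have "z = snd (slit_chart A c) (p, coord_vector A c p (snd z))"
    using p coord_vector_self[OF A p(1)] by (simp add: slit_chart_def prod_eq_iff)
  moreover have "(p, coord_vector A c p (snd z)) \<in> fst (slit_chart A c)"
    using p coord_vector_slit[OF A p(1)] by (simp add: slit_chart_def)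
  ultimately show "z \<in> chart_image (slit_chart A c)" unfolding chart_image_def by blast
qed

lemma open_slit_chart_image:
  fixes A :: "('m::topological_space, real^'n) chart set"
  shows "\<lbrakk>smooth_atlas A; c \<in> A\<rbrakk> \<Longrightarrow> open (chart_image (slit_chart A c))"
  unfolding slit_chart_image by (intro open_Times open_chart_image open_Compl closed_singleton)

lemma slit_chart_inv:
  fixes A :: "('m::topological_space, real^'n) chart set"
  assumes A: "smooth_atlas A" "c \<in> A" and p: "p \<in> fst c" and v: "v \<in> tangent_space A p" "v c \<noteq> 0"
  shows "chart_inv (slit_chart A c) (snd c p, v c) = (p, v)"
proof -
  have "inj_on (snd (slit_chart A c)) (fst (slit_chart A c))"
  proof (rule inj_onI, clarsimp simp: slit_chart_def slit_bundle_def)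
    fix p v q w
    assume h: "snd c p = snd c q" "v c = w c" "p \<in> fst c" "q \<in> fst c"
      "v \<in> tangent_space A p" "w \<in> tangent_space A q"
    then have "p = q" using chart_inv_left[OF A] by metis
    with h show "p = q \<and> v = w" using coord_vector_eq[OF _ A(2)] by metis
  qed
  moreover have "(p, v) \<in> fst (slit_chart A c)" "snd (slit_chart A c) (p, v) = (snd c p, v c)"
    using p v by (auto simp: slit_chart_def slit_bundle_def)
  ultimately show ?thesis unfolding chart_inv_def by (metis inv_into_f_f)
qed

lemma slit_rep_apply:
  fixes A :: "('m::topological_space, real^'n) chart set"
  assumes A: "smooth_atlas A" "c \<in> A" and p: "p \<in> fst c" and v: "v \<in> tangent_space A p" "v c \<noteq> 0"
  shows "slit_rep A c F (snd c p, v c) = F (p, v)"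
  by (simp add: slit_rep_def coord_rep_def slit_chart_inv[OF assms])

text \<open>Every coordinate point of the slit bundle is presented by an abstract tangent vector, whose
components are then available in all charts at once.\<close>

lemma slit_chart_point:
  fixes A :: "('m::topological_space, real^'n) chart set"
  assumes A: "smooth_atlas A" "c \<in> A" and z: "z \<in> chart_image (slit_chart A c)"
  obtains p v where "p \<in> fst c" "v \<in> tangent_space A p" "v c \<noteq> 0" "z = (snd c p, v c)"
proof -
  obtain p where p: "p \<in> fst c" "fst z = snd c p" "snd z \<noteq> 0"
    using z unfolding slit_chart_image[OF A] by (cases z) (auto simp: chart_image_def)
  then show ?thesis
    using that[of p "coord_vector A c p (snd z)"] coord_vector_tangent[OF A p(1)]
      coord_vector_self[OF A p(1)] by (simp add: prod_eq_iff)
qed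

lemma transition_slit_chart:
  fixes A :: "('m::topological_space, real^'n) chart set"
  assumes A: "smooth_atlas A" "c \<in> A" "d \<in> A"
    and p: "p \<in> fst c" "p \<in> fst d" and v: "v \<in> tangent_space A p" "v c \<noteq> 0"
  shows "transition (slit_chart A c) (slit_chart A d) (snd c p, v c) = (snd d p, v d)"
    and "tangent_map (transition c d) (snd c p, v c) = (snd d p, v d)"
proof -
  show "transition (slit_chart A c) (slit_chart A d) (snd c p, v c) = (snd d p, v d)"
    unfolding transition_def slit_chart_inv[OF A(1,2) p(1) v] by (simp add: slit_chart_def)
  show "tangent_map (transition c d) (snd c p, v c) = (snd d p, v d)"
    using tangent_space_change[OF v(1) A(2,3) p]
    by (simp add: tangent_map_def transition_apply[OF A(1,2) p(1)])
qed

lemma finsler_slit_rep: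
  fixes A :: "('m::topological_space, real^'n) chart set"
  assumes A: "smooth_atlas A" "c \<in> A" and F: "finsler A F"
  shows "smooth_on (chart_image (slit_chart A c)) (slit_rep A c F)"
    and "z \<in> chart_image (slit_chart A c) \<Longrightarrow> slit_rep A c F z > 0"
    and "\<lbrakk>(x, y) \<in> chart_image (slit_chart A c); t > 0\<rbrakk>
      \<Longrightarrow> slit_rep A c F (x, t *\<^sub>R y) = t * slit_rep A c F (x, y)"
proof -
  show "smooth_on (chart_image (slit_chart A c)) (slit_rep A c F)"
    using F A by (auto simp: finsler_def smooth_function_def slit_atlas_def slit_rep_def)
  show "slit_rep A c F z > 0" if z: "z \<in> chart_image (slit_chart A c)"
  proof -
    obtain p v where pv: "p \<in> fst c" "v \<in> tangent_space A p" "v c \<noteq> 0" "z = (snd c p, v c)"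
      using slit_chart_point[OF A z] .
    then have "(p, v) \<in> slit_bundle A" by (auto simp: slit_bundle_def)
    then show ?thesis using F pv slit_rep_apply[OF A pv(1-3), of F] by (simp add: finsler_def)
  qed
  show "slit_rep A c F (x, t *\<^sub>R y) = t * slit_rep A c F (x, y)"
    if xy: "(x, y) \<in> chart_image (slit_chart A c)" and t: "t > 0"
  proof -
    obtain p v where pv: "p \<in> fst c" "v \<in> tangent_space A p" "v c \<noteq> 0" "(x, y) = (snd c p, v c)"
      using slit_chart_point[OF A xy] .
    let ?w = "\<lambda>d. t *\<^sub>R v d"
    have w: "?w \<in> tangent_space A p"
    proof -
      have "?w e = dir_deriv (?w d) (transition d e) (snd d p)"
        if "d \<in> A" "e \<in> A" "p \<in> fst d" "p \<in> fst e" for d e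
        using tangent_space_change[OF pv(2) that]
          linear_cmul[OF linear_dir_deriv[OF transition_differentiable[OF A(1) that]], of t "v d"]
        by simp
      moreover have "?w e = 0" if "\<not> (e \<in> A \<and> p \<in> fst e)" for e
        using tangent_space_outside[OF pv(2) that] by simp
      ultimately show ?thesis unfolding tangent_space_def dir_deriv_def by blast
    qed
    have "F (p, ?w) = t * F (p, v)"
      using F pv(2) t by (auto simp: finsler_def tangent_bundle_def)
    then show ?thesis
      using slit_rep_apply[OF A pv(1-3), of F] slit_rep_apply[OF A pv(1) w, of F] pv(3,4) t by simp
  qed
qed

text \<open>On the slit bundle the transition maps are the tangent maps of the transition maps of the base, so
vector fields there change by the differential of \<^const>\<open>tangent_map\<close>.\<close>

lemma vector_field_change:
  fixes A :: "('m::topological_space, real^'n) chart set"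
  assumes A: "smooth_atlas A" "c \<in> A" "d \<in> A" and X: "vector_field (slit_atlas A) X"
    and p: "p \<in> fst c" "p \<in> fst d" and v: "v \<in> tangent_space A p" "v c \<noteq> 0"
  shows "vector_rep (slit_chart A d) X (snd d p, v d)
    = dir_deriv (vector_rep (slit_chart A c) X (snd c p, v c)) (tangent_map (transition c d)) (snd c p, v c)"
proof -
  let ?T = "transition (slit_chart A c) (slit_chart A d)"
  let ?W = "snd c ` (fst c \<inter> fst d) \<times> - {0 :: real^'n}"
  have vd: "v d \<noteq> 0" using tangent_component_zero_iff[OF A(1) v(1)] A p v(2) by metis
  have inv: "(p, v) \<in> fst (slit_chart A c)" "(p, v) \<in> fst (slit_chart A d)"
    using p v by (auto simp: slit_chart_def slit_bundle_def)
  have sl: "slit_chart A c \<in> slit_atlas A" "slit_chart A d \<in> slit_atlas A"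
    using A by (auto simp: slit_atlas_def)
  have "X (p, v) \<in> tangent_space (slit_atlas A) (p, v)"
    using X inv sl unfolding vector_field_def by blast
  then have "X (p, v) (slit_chart A d) = dir_deriv (X (p, v) (slit_chart A c)) ?T (snd c p, v c)"
    using tangent_space_change[OF _ sl inv] by (simp add: slit_chart_def)
  also have "\<dots> = dir_deriv (X (p, v) (slit_chart A c)) (tangent_map (transition c d)) (snd c p, v c)"
  proof (rule dir_deriv_cong[symmetric])
    show "open ?W"
      by (intro open_Times open_chart_overlap[OF A] open_Compl closed_singleton)
    show "(snd c p, v c) \<in> ?W" using p v by auto
    show "tangent_map (transition c d) differentiable at (snd c p, v c)"
      using has_derivative_tangent_map[OF open_chart_overlap[OF A] _ smooth_transition[OF A],
          of "(snd c p, v c)"] p differentiableI by fastforce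
    fix w assume "w \<in> ?W"
    then obtain q y where q: "q \<in> fst c" "q \<in> fst d" "y \<noteq> 0" "w = (snd c q, y)" by auto
    show "tangent_map (transition c d) w = ?T w"
      using transition_slit_chart[OF A q(1,2) coord_vector_tangent[OF A(1,2) q(1)], of y]
        coord_vector_self[OF A(1,2) q(1)] q(3,4) by simp
  qed
  finally show ?thesis
    by (simp add: vector_rep_def slit_chart_inv[OF A(1,2) p(1) v] slit_chart_inv[OF A(1,3) p(2) v(1) vd])
qed

lemma spray_rep:
  fixes A :: "('m::topological_space, real^'n) chart set"
  assumes S: "spray A S" and c: "c \<in> A"
  shows "smooth_on (chart_image (slit_chart A c)) (spray_coeff A c S)"
    and "smooth_on (chart_image (slit_chart A c)) (vector_rep (slit_chart A c) S)"
    and "\<lbrakk>(x, y) \<in> chart_image (slit_chart A c); t > 0\<rbrakk>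
      \<Longrightarrow> spray_coeff A c S (x, t *\<^sub>R y) = t\<^sup>2 *\<^sub>R spray_coeff A c S (x, y)"
    and "z \<in> chart_image (slit_chart A c)
      \<Longrightarrow> vector_rep (slit_chart A c) S z = (snd z, - 2 *\<^sub>R spray_coeff A c S z)"
proof -
  have *: "smooth_on (chart_image (slit_chart A c)) (spray_coeff A c S)"
    "\<forall>(x, y)\<in>chart_image (slit_chart A c). \<forall>t>0. spray_coeff A c S (x, t *\<^sub>R y) = t\<^sup>2 *\<^sub>R spray_coeff A c S (x, y)"
    "\<forall>(x, y)\<in>chart_image (slit_chart A c).
      vector_rep (slit_chart A c) S (x, y) = (y, - 2 *\<^sub>R spray_coeff A c S (x, y))"
    using S c by (auto simp: spray_def Let_def)
  show "smooth_on (chart_image (slit_chart A c)) (spray_coeff A c S)" by (rule *(1))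
  show "smooth_on (chart_image (slit_chart A c)) (vector_rep (slit_chart A c) S)"
    using S c unfolding spray_def vector_field_def slit_atlas_def by blast
  show "spray_coeff A c S (x, t *\<^sub>R y) = t\<^sup>2 *\<^sub>R spray_coeff A c S (x, y)"
    if "(x, y) \<in> chart_image (slit_chart A c)" "t > 0" using *(2) that by blast
  show "vector_rep (slit_chart A c) S z = (snd z, - 2 *\<^sub>R spray_coeff A c S z)"
    if "z \<in> chart_image (slit_chart A c)" using *(3) that by (cases z) auto
qed

section \<open>The Euler-Lagrange form of a Finsler structure\<close>

definition euler_lagrange_form ::
    "('m, real^'n) chart set \<Rightarrow> ('m, 'n) slit_field \<Rightarrow> (('m, 'n) tpoint \<Rightarrow> real) \<Rightarrow>
     ('m, real^'n) chart \<Rightarrow> real^'n \<Rightarrow> (real^'n) \<times> (real^'n) \<Rightarrow> real" where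
  "euler_lagrange_form A S F c = euler_lagrange (slit_rep A c F) (vector_rep (slit_chart A c) S)"

text \<open>Both \<open>F\<close> and \<open>S\<close> in the second chart are related to those in the first by the tangent map of the
transition map, so \<open>euler_lagrange_tangent_map\<close> applies. Here \<open>v\<close> is the point of the slit bundle and
\<open>u\<close> the vector of the base on which the form is evaluated.\<close>

lemma euler_lagrange_form_change:
  fixes A :: "('m::topological_space, real^'n) chart set"
  assumes A: "smooth_atlas A" "c \<in> A" "d \<in> A" and S: "spray A S" and F: "finsler A F"
    and p: "p \<in> fst c" "p \<in> fst d"
    and u: "u \<in> tangent_space A p" and v: "v \<in> tangent_space A p" "v c \<noteq> 0"
  shows "euler_lagrange_form A S F c (u c) (snd c p, v c) = euler_lagrange_form A S F d (u d) (snd d p, v d)"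
proof -
  let ?W = "snd c ` (fst c \<inter> fst d) \<times> - {0 :: real^'n}" and ?z = "(snd c p, v c)"
  have Wo: "open ?W"
    by (intro open_Times open_chart_overlap[OF A] open_Compl closed_singleton)
  have z: "?z \<in> ?W" using p v by auto
  have zc: "?z \<in> chart_image (slit_chart A c)"
    using p v unfolding slit_chart_image[OF A(1,2)] by (auto simp: chart_image_def)
  have W: "tangent_map (transition c d) w \<in> chart_image (slit_chart A d)
      \<and> slit_rep A c F w = slit_rep A d F (tangent_map (transition c d) w)" if w: "w \<in> ?W" for w
  proof -
    obtain q y where q: "q \<in> fst c" "q \<in> fst d" "y \<noteq> 0" "w = (snd c q, y)" using w by auto
    define v where "v = coord_vector A c q y"
    have v: "v \<in> tangent_space A q" "v c = y"
      using coord_vector_tangent[OF A(1,2) q(1)] coord_vector_self[OF A(1,2) q(1)] by (auto simp: v_def)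
    have vd: "v d \<noteq> 0" using tangent_component_zero_iff[OF A(1) v(1)] A q v(2) by metis
    have "tangent_map (transition c d) w = (snd d q, v d)"
      using transition_slit_chart(2)[OF A q(1,2) v(1)] v q by simp
    moreover have "slit_rep A c F w = slit_rep A d F (snd d q, v d)"
      using slit_rep_apply[OF A(1,2) q(1) v(1), of F] slit_rep_apply[OF A(1,3) q(2) v(1) vd, of F] v q by simp
    ultimately show ?thesis
      using q vd unfolding slit_chart_image[OF A(1,3)] by (auto simp: chart_image_def)
  qed
  have Tz: "tangent_map (transition c d) ?z = (snd d p, v d)"
    by (rule transition_slit_chart(2)[OF A p v])
  have ud: "dir_deriv (u c) (transition c d) (snd c p) = u d"
    using tangent_space_change[OF u A(2,3) p] by simp
  have vf: "vector_field (slit_atlas A) S" using S by (simp add: spray_def)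
  have "euler_lagrange (slit_rep A c F) (vector_rep (slit_chart A c) S) (u c) ?z
      = euler_lagrange (slit_rep A d F) (vector_rep (slit_chart A d) S)
         (dir_deriv (u c) (transition c d) (fst ?z)) (tangent_map (transition c d) ?z)"
  proof (rule euler_lagrange_tangent_map[OF open_chart_overlap[OF A] smooth_transition[OF A] Wo _ z
        open_slit_chart_image[OF A(1,3)] _ finsler_slit_rep(1)[OF A(1,3) F]])
    show "fst (vector_rep (slit_chart A c) S ?z) = snd ?z"
      using spray_rep(4)[OF S A(2) zc] by simp
    show "vector_rep (slit_chart A d) S (tangent_map (transition c d) ?z)
        = dir_deriv (vector_rep (slit_chart A c) S ?z) (tangent_map (transition c d)) ?z"
      unfolding Tz by (rule vector_field_change[OF A vf p v])
  qed (use W in auto)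
  then show ?thesis by (simp add: euler_lagrange_form_def Tz ud)
qed

section \<open>The dynamical covariant derivative of the angular metric\<close>

lemma dir_deriv_fibre:
  assumes "g differentiable (at (x, y))"
  shows "((\<lambda>y. g (x, y)) has_derivative (\<lambda>v. dir_deriv (0, v) g (x, y))) (at y)"
proof -
  have "bounded_linear (\<lambda>y. (0, y))"
    by (intro bounded_linear_Pair bounded_linear_zero bounded_linear_ident)
  from has_derivative_compose_affine[OF this, of g y "(x, 0)"] show ?thesis
    using assms by simp
qed

lemma linear_axis_expansion:
  fixes L :: "real^'n \<Rightarrow> real"
  assumes "linear L"
  shows "L w = (\<Sum>k\<in>UNIV. w $ k * L (axis k 1))"
proof -
  have "L w = L (\<Sum>k\<in>UNIV. w $ k *\<^sub>R axis k 1)"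
    by (simp only: basis_expansion[of w, unfolded scalar_mult_eq_scaleR])
  also have "\<dots> = (\<Sum>k\<in>UNIV. w $ k * L (axis k 1))"
    by (simp add: linear_sum[OF assms] linear_cmul[OF assms])
  finally show ?thesis .
qed

lemma dy_eq_dir_deriv: "dy i f = dir_deriv (0, axis i 1) f"
  by (simp add: dy_def dir_deriv_def)

text \<open>Since \<open>\<partial>\<^sub>i \<partial>\<^sub>j F\<^sup>2 = 2 F \<partial>\<^sub>i \<partial>\<^sub>j F + 2 \<partial>\<^sub>i F \<partial>\<^sub>j F\<close> in the fibre coordinates, subtracting the
product of first derivatives and dividing by \<open>F\<close> leaves the Hessian.\<close>

lemma angular_metric_eq_hessian:
  fixes A :: "('m::topological_space, real^'n) chart set"
  assumes A: "smooth_atlas A" "c \<in> A" and F: "finsler A F" and z: "z \<in> chart_image (slit_chart A c)"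
  shows "1 / slit_rep A c F z *
      (metric_tensor A c F i j z - dy i (slit_rep A c F) z * dy j (slit_rep A c F) z)
    = dy i (dy j (slit_rep A c F)) z"
proof -
  let ?f = "slit_rep A c F" and ?D = "chart_image (slit_chart A c)"
  let ?a = "(0 :: real^'n, axis i (1::real))" and ?b = "(0 :: real^'n, axis j (1::real))"
  note D = open_slit_chart_image[OF A] and f = finsler_slit_rep(1)[OF A F]
  have sq: "((\<lambda>w. (?f w)\<^sup>2) has_derivative (\<lambda>h. 2 * ?f w * dir_deriv h ?f w)) (at w)"
    if "w \<in> ?D" for w
    using has_derivative_power[OF has_derivative_dir_deriv[OF smooth_on_differentiable[OF f that]], of 2]
    by (simp add: mult_ac)
  have "((\<lambda>w. 2 * ?f w * dir_deriv ?b ?f w) has_derivative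
      (\<lambda>h. 2 * ?f z * dir_deriv h (dir_deriv ?b ?f) z + 2 * dir_deriv h ?f z * dir_deriv ?b ?f z)) (at z)"
    by (intro has_derivative_mult has_derivative_mult_right has_derivative_dir_deriv
        smooth_on_differentiable[OF _ z] smooth_on_dir_deriv f)
  then have "(dir_deriv ?b (\<lambda>w. (?f w)\<^sup>2) has_derivative
      (\<lambda>h. 2 * ?f z * dir_deriv h (dir_deriv ?b ?f) z + 2 * dir_deriv h ?f z * dir_deriv ?b ?f z)) (at z)"
    by (rule has_derivative_transform_within_open[OF _ D z]) (simp add: dir_deriv_eq[OF sq])
  from dir_deriv_eq[OF this, of ?a]
  have "metric_tensor A c F i j z
      = ?f z * dir_deriv ?a (dir_deriv ?b ?f) z + dir_deriv ?a ?f z * dir_deriv ?b ?f z"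
    by (simp add: metric_tensor_def dy_eq_dir_deriv)
  then show ?thesis
    using finsler_slit_rep(2)[OF A F z] by (simp add: dy_eq_dir_deriv)
qed

text \<open>The key identity: \<open>\<nabla> h\<^sub>i\<^sub>j\<close> is the symmetric part of the vertical derivative of the
Euler-Lagrange form. Both directions of the theorem start from it.\<close>

lemma nabla_angular_metric:
  fixes A :: "('m::topological_space, real^'n) chart set"
  assumes A: "smooth_atlas A" "c \<in> A" and S: "spray A S" and F: "finsler A F"
    and z: "z \<in> chart_image (slit_chart A c)"
  shows "2 * nabla A c S
          (\<lambda>i j w. 1 / slit_rep A c F w *
             (metric_tensor A c F i j w - dy i (slit_rep A c F) w * dy j (slit_rep A c F) w)) i j z
    = dy j (euler_lagrange_form A S F c (axis i 1)) z + dy i (euler_lagrange_form A S F c (axis j 1)) z"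
proof -
  let ?f = "slit_rep A c F" and ?D = "chart_image (slit_chart A c)"
  let ?X = "vector_rep (slit_chart A c) S" and ?G = "spray_coeff A c S"
  let ?e = "\<lambda>k. (0 :: real^'n, axis k (1::real))"
  define h where "h = (\<lambda>i j w. 1 / ?f w * (metric_tensor A c F i j w - dy i ?f w * dy j ?f w))"
  note D = open_slit_chart_image[OF A] and f = finsler_slit_rep(1)[OF A F]
    and G = spray_rep(1)[OF S A(2)] and X = spray_rep(4)[OF S A(2)]
  have h: "h i j w = dir_deriv (?e i) (dir_deriv (?e j) ?f) w" if "w \<in> ?D" for i j w
    using angular_metric_eq_hessian[OF A F that] by (simp add: h_def dy_eq_dir_deriv)
  have h_sym: "h i j z = h j i z" for i j
    unfolding h[OF z] by (rule dir_deriv_commute[OF D z f])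
  have N: "nonlinear_conn A c S k i z = dir_deriv (?e i) ?G z $ k" for k i
    unfolding nonlinear_conn_def dy_eq_dir_deriv
    by (rule dir_deriv_eq, rule bounded_linear.has_derivative[OF bounded_linear_vec_nth])
      (intro has_derivative_dir_deriv smooth_on_differentiable[OF G z])
  have sum: "(\<Sum>k\<in>UNIV. nonlinear_conn A c S k i z * h k j z)
      = dir_deriv (0, dir_deriv (?e i) ?G z) (dir_deriv (?e j) ?f) z" for i j
  proof -
    have "linear (\<lambda>v. dir_deriv (0, v) (dir_deriv (?e j) ?f) z)"
    proof -
      have "linear (\<lambda>v. dir_deriv v (dir_deriv (?e j) ?f) z)"
        by (intro linear_dir_deriv smooth_on_differentiable[OF _ z] smooth_on_dir_deriv f)
      moreover have "linear (\<lambda>v::real^'n. (0::real^'n, v))" by (auto intro!: linearI)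
      ultimately show ?thesis using linear_compose[unfolded o_def] by blast
    qed
    from linear_axis_expansion[OF this, of "dir_deriv (?e i) ?G z"] show ?thesis
      by (simp add: N h[OF z])
  qed
  have "spray_deriv A c S (h i j) z = dir_deriv (?X z) (h i j) z"
    by (simp add: spray_deriv_def dir_deriv_def)
  also have "\<dots> = dir_deriv (?X z) (dir_deriv (?e i) (dir_deriv (?e j) ?f)) z"
    by (rule dir_deriv_cong[OF D z, symmetric])
      (use h in \<open>auto intro!: smooth_on_differentiable[OF _ z] smooth_on_dir_deriv f\<close>)
  finally have "nabla A c S h i j z = dir_deriv (?X z) (dir_deriv (?e i) (dir_deriv (?e j) ?f)) z
      - dir_deriv (0, dir_deriv (?e i) ?G z) (dir_deriv (?e j) ?f) z
      - dir_deriv (0, dir_deriv (?e j) ?G z) (dir_deriv (?e i) ?f) z"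
    using sum[of i j] sum[of j i] by (simp add: nabla_def h_sym[of i])
  moreover have "dir_deriv (?e i) (euler_lagrange ?f ?X (axis j 1)) z
      + dir_deriv (?e j) (euler_lagrange ?f ?X (axis i 1)) z
    = 2 * (dir_deriv (?X z) (dir_deriv (?e i) (dir_deriv (?e j) ?f)) z
      - dir_deriv (0, dir_deriv (?e i) ?G z) (dir_deriv (?e j) ?f) z
      - dir_deriv (0, dir_deriv (?e j) ?G z) (dir_deriv (?e i) ?f) z)"
    by (rule vertical_deriv_euler_lagrange_sym[OF D z f G X])
  ultimately show ?thesis
    unfolding h_def[symmetric] by (simp add: euler_lagrange_form_def dy_eq_dir_deriv)
qed

lemma smooth_euler_lagrange_form:
  fixes A :: "('m::topological_space, real^'n) chart set"
  assumes A: "smooth_atlas A" "c \<in> A" and S: "spray A S" and F: "finsler A F"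
  shows "smooth_on (chart_image (slit_chart A c)) (euler_lagrange_form A S F c u)"
  unfolding euler_lagrange_form_def
  by (intro smooth_on_euler_lagrange open_slit_chart_image finsler_slit_rep(1) spray_rep(2) assms)

lemma linear_euler_lagrange_form:
  fixes A :: "('m::topological_space, real^'n) chart set"
  assumes A: "smooth_atlas A" "c \<in> A" and F: "finsler A F"
    and z: "z \<in> chart_image (slit_chart A c)"
  shows "linear (\<lambda>u. euler_lagrange_form A S F c u z)"
  unfolding euler_lagrange_form_def
  by (rule linear_euler_lagrange[OF open_slit_chart_image[OF A] z finsler_slit_rep(1)[OF A F]])

lemma euler_lagrange_form_axis:
  "euler_lagrange_form A S F c (axis i 1) z
    = spray_deriv A c S (dy i (slit_rep A c F)) z - dx i (slit_rep A c F) z"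
  by (simp add: euler_lagrange_form_def euler_lagrange_def spray_deriv_def dx_def dy_def dir_deriv_def)

lemma two_form_comp_skew:
  fixes A :: "('m::topological_space, real^'n) chart set"
  assumes A: "smooth_atlas A" "c \<in> A" and \<omega>: "two_form A \<omega>" and x: "x \<in> chart_image c"
  shows "two_form_comp A c \<omega> i j x = - two_form_comp A c \<omega> j i x"
  using \<omega> coord_vector_tangent[OF A chart_image_inv(1)[OF A x]]
  unfolding two_form_def two_form_comp_def Let_def by blast

lemma dy_linear_on_fibre:
  fixes g :: "(real^'n) \<times> (real^'n) \<Rightarrow> real"
  assumes g: "g differentiable (at (x, y))" and "y \<noteq> 0"
    and lin: "\<And>y. y \<noteq> 0 \<Longrightarrow> g (x, y) = (\<Sum>j\<in>UNIV. a j * y $ j)"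
  shows "dy k g (x, y) = a k"
proof -
  have "((\<lambda>y. \<Sum>j\<in>UNIV. a j * y $ j) has_derivative (\<lambda>v. \<Sum>j\<in>UNIV. a j * v $ j)) (at y)"
    by (intro has_derivative_sum has_derivative_mult_right
        bounded_linear.has_derivative[OF bounded_linear_vec_nth] has_derivative_ident)
  moreover have "((\<lambda>y. \<Sum>j\<in>UNIV. a j * y $ j) has_derivative (\<lambda>v. dir_deriv (0, v) g (x, y))) (at y)"
    by (rule has_derivative_transform_within_open[OF dir_deriv_fibre[OF g], of "- {0}"])
      (use assms in \<open>auto intro!: open_Compl closed_singleton\<close>)
  ultimately have "(\<lambda>v. \<Sum>j\<in>UNIV. a j * v $ j) = (\<lambda>v. dir_deriv (0, v) g (x, y))"
    by (rule has_derivative_unique)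
  from fun_cong[OF this, of "axis k 1"] show ?thesis
    by (simp add: dy_eq_dir_deriv axis_def if_distrib cong: if_cong)
qed

section \<open>The gyroscopic two-form\<close>

text \<open>The vertical derivative of the Euler-Lagrange form is bilinear in the vector of the form and the
direction of differentiation, so skewness needs to be known on the coordinate vectors only.\<close>

lemma dir_deriv_skew_of_axis:
  fixes A :: "('m::topological_space, real^'n) chart set"
  assumes A: "smooth_atlas A" "c \<in> A" and S: "spray A S" and F: "finsler A F"
    and z: "z \<in> chart_image (slit_chart A c)"
    and skew: "\<And>i j. dy j (euler_lagrange_form A S F c (axis i 1)) z
      = - dy i (euler_lagrange_form A S F c (axis j 1)) z"
  shows "dir_deriv (0, v) (euler_lagrange_form A S F c u) z
    = - dir_deriv (0, u) (euler_lagrange_form A S F c v) z"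
proof -
  let ?E = "euler_lagrange_form A S F c" and ?D = "chart_image (slit_chart A c)"
  let ?B = "\<lambda>u v. dir_deriv (0, v) (?E u) z"
  note D = open_slit_chart_image[OF A] and sm = smooth_euler_lagrange_form[OF A S F]
  have 1: "?B u v = (\<Sum>j\<in>UNIV. v $ j * ?B u (axis j 1))" for u v
  proof -
    have "linear (\<lambda>v. dir_deriv v (?E u) z)"
      by (intro linear_dir_deriv smooth_on_differentiable[OF sm z])
    moreover have "linear (\<lambda>v::real^'n. (0::real^'n, v))" by (auto intro!: linearI)
    ultimately have "linear (?B u)" using linear_compose[unfolded o_def] by blast
    from linear_axis_expansion[OF this] show ?thesis .
  qed
  have 2: "?B u v = (\<Sum>i\<in>UNIV. u $ i * ?B (axis i 1) v)" for u v
  proof -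
    have "((\<lambda>w. \<Sum>i\<in>UNIV. u $ i * ?E (axis i 1) w) has_derivative
        (\<lambda>h. \<Sum>i\<in>UNIV. u $ i * dir_deriv h (?E (axis i 1)) z)) (at z)"
      by (intro has_derivative_sum has_derivative_mult_right has_derivative_dir_deriv
          smooth_on_differentiable[OF sm z])
    then have "(?E u has_derivative (\<lambda>h. \<Sum>i\<in>UNIV. u $ i * dir_deriv h (?E (axis i 1)) z)) (at z)"
    proof (rule has_derivative_transform_within_open[OF _ D z])
      fix w assume "w \<in> ?D"
      from linear_axis_expansion[OF linear_euler_lagrange_form[OF A F this], of S u]
      show "(\<Sum>i\<in>UNIV. u $ i * ?E (axis i 1) w) = ?E u w" by simp
    qed
    from dir_deriv_eq[OF this] show ?thesis .
  qed
  have "?B u v = (\<Sum>j\<in>UNIV. v $ j * (\<Sum>i\<in>UNIV. u $ i * ?B (axis i 1) (axis j 1)))"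
    by (rule trans[OF 1]) (intro sum.cong refl arg_cong2[where f = "(*)"] 2)
  also have "\<dots> = (\<Sum>j\<in>UNIV. v $ j * (\<Sum>i\<in>UNIV. u $ i * - ?B (axis j 1) (axis i 1)))"
    by (intro sum.cong refl arg_cong2[where f = "(*)"] skew[unfolded dy_eq_dir_deriv])
  also have "\<dots> = - (\<Sum>j\<in>UNIV. v $ j * (\<Sum>i\<in>UNIV. u $ i * ?B (axis j 1) (axis i 1)))"
    by (simp add: sum_negf)
  also have "(\<Sum>j\<in>UNIV. v $ j * (\<Sum>i\<in>UNIV. u $ i * ?B (axis j 1) (axis i 1))) = ?B v u"
    by (rule trans[OF _ 2[symmetric]]) (intro sum.cong refl arg_cong2[where f = "(*)"] 1[symmetric])
  finally show ?thesis .
qed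

text \<open>The restriction of the form to the fibre over \<open>x\<close> is an instance of \<open>skew_of_dir_deriv_skew\<close>; its
homogeneity comes from that of \<open>F\<close> and of the spray.\<close>

lemma euler_lagrange_form_skew:
  fixes A :: "('m::topological_space, real^'n) chart set"
  assumes A: "smooth_atlas A" "c \<in> A" and S: "spray A S" and F: "finsler A F"
    and skew: "\<And>i j z. z \<in> chart_image (slit_chart A c) \<Longrightarrow>
      dy j (euler_lagrange_form A S F c (axis i 1)) z = - dy i (euler_lagrange_form A S F c (axis j 1)) z"
    and x: "x \<in> chart_image c" and uv: "u \<noteq> 0" "v \<noteq> 0"
  shows "euler_lagrange_form A S F c u (x, v) = - euler_lagrange_form A S F c v (x, u)"
proof -
  let ?E = "euler_lagrange_form A S F c" and ?D = "chart_image (slit_chart A c)"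
  note sm = smooth_euler_lagrange_form[OF A S F]
  have D: "(x, y) \<in> ?D \<longleftrightarrow> y \<noteq> 0" for y
    using x by (simp add: slit_chart_image[OF A])
  have fibre: "dir_deriv b (\<lambda>y. ?E a (x, y)) y = dir_deriv (0, b) (?E a) (x, y)" if "y \<noteq> 0" for a b y
    by (rule dir_deriv_eq[OF dir_deriv_fibre[OF smooth_on_differentiable[OF sm]]]) (simp add: D that)
  have "(\<lambda>y. ?E u (x, y)) v = - (\<lambda>y. ?E v (x, y)) u"
  proof (rule skew_of_dir_deriv_skew[where L = "\<lambda>u y. ?E u (x, y)", OF _ _ _ uv])
    fix a
    have "bounded_linear (\<lambda>y::real^'n. (0::real^'n, y))"
      by (intro bounded_linear_Pair bounded_linear_zero bounded_linear_ident)
    then have "smooth_on (- {0}) (\<lambda>y. ?E a ((0, y) + (x, 0)))"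
      by (rule smooth_on_compose_affine[OF open_Compl[OF closed_singleton] _ _ sm]) (simp add: D)
    then show "smooth_on (- {0}) (\<lambda>y. ?E a (x, y))" by simp
  next
    fix a b y :: "real^'n" assume y: "y \<noteq> 0"
    then have xy: "(x, y) \<in> ?D" by (simp add: D)
    show "dir_deriv b (\<lambda>y. ?E a (x, y)) y = - dir_deriv a (\<lambda>y. ?E b (x, y)) y"
      unfolding fibre[OF y] by (rule dir_deriv_skew_of_axis[OF A S F xy]) (rule skew[OF xy])
  next
    fix a y :: "real^'n" and t :: real assume "y \<noteq> 0" and t: "t > 0"
    then have xy: "(x, y) \<in> ?D" by (simp add: D)
    show "?E a (x, t *\<^sub>R y) = t * ?E a (x, y)"
      unfolding euler_lagrange_form_def
      by (rule euler_lagrange_homogeneous[OF open_slit_chart_image[OF A] xy t _ finsler_slit_rep(1)[OF A F]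
            spray_rep(4)[OF S A(2)] finsler_slit_rep(3)[OF A F _ t] spray_rep(3)[OF S A(2) _ t]])
        (use t in \<open>auto simp: slit_chart_image[OF A]\<close>)
  qed
  then show ?thesis by simp
qed

text \<open>The Euler-Lagrange form with the point \<open>v\<close> of the slit bundle reread as a second argument and
extended by zero to \<open>v = 0\<close>. The chart is chosen arbitrarily; \<open>gyroscopic_form_eq\<close> shows that the
choice has no influence on tangent vectors.\<close>

definition gyroscopic_form ::
    "('m, real^'n) chart set \<Rightarrow> ('m, 'n) slit_field \<Rightarrow> (('m, 'n) tpoint \<Rightarrow> real) \<Rightarrow>
     'm \<Rightarrow> ('m, real^'n) tvec \<Rightarrow> ('m, real^'n) tvec \<Rightarrow> real" where
  "gyroscopic_form A S F p u v = (let c = SOME c. c \<in> A \<and> p \<in> fst c in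
     if v c = 0 then 0 else euler_lagrange_form A S F c (u c) (snd c p, v c))"

lemma gyroscopic_form_eq:
  fixes A :: "('m::topological_space, real^'n) chart set"
  assumes A: "smooth_atlas A" "c \<in> A" and S: "spray A S" and F: "finsler A F" and p: "p \<in> fst c"
    and u: "u \<in> tangent_space A p" and v: "v \<in> tangent_space A p"
  shows "gyroscopic_form A S F p u v =
    (if v c = 0 then 0 else euler_lagrange_form A S F c (u c) (snd c p, v c))"
proof -
  define d where "d = (SOME c. c \<in> A \<and> p \<in> fst c)"
  have d: "d \<in> A" "p \<in> fst d"
    using someI[of "\<lambda>c. c \<in> A \<and> p \<in> fst c" c] A(2) p by (auto simp: d_def)
  have "v d = 0 \<longleftrightarrow> v c = 0"
    using tangent_component_zero_iff[OF A(1) v] A(2) d p by metis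
  then show ?thesis
    using euler_lagrange_form_change[OF A d(1) S F p d(2) u v]
    by (simp add: gyroscopic_form_def Let_def d_def[symmetric])
qed

lemma gyroscopic_form_comp:
  fixes A :: "('m::topological_space, real^'n) chart set"
  assumes A: "smooth_atlas A" "c \<in> A" and S: "spray A S" and F: "finsler A F" and x: "x \<in> chart_image c"
  shows "two_form_comp A c (gyroscopic_form A S F) i j x
    = euler_lagrange_form A S F c (axis i 1) (x, axis j 1)"
proof -
  let ?p = "chart_inv c x"
  note p = chart_image_inv(1)[OF A x]
  have "(axis j 1 :: real^'n) \<noteq> 0" by (simp add: axis_eq_0_iff)
  then show ?thesis
    using gyroscopic_form_eq[OF A S F p coord_vector_tangent[OF A p] coord_vector_tangent[OF A p],
        of "axis i 1" "axis j 1"] chart_image_inv(2)[OF A x]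
    by (simp add: two_form_comp_def Let_def coord_vector_self[OF A p])
qed

text \<open>The Euler-Lagrange form is linear in its vector argument by construction, and skewness carries
this over to the point of the fibre. The components in a chart are smooth because they are values
of the form along the constant fields \<open>y = e\<^sub>j\<close>.\<close>

lemma two_form_gyroscopic_form:
  fixes A :: "('m::topological_space, real^'n) chart set"
  assumes A: "smooth_atlas A" and S: "spray A S" and F: "finsler A F"
    and skew: "\<And>c x u v. \<lbrakk>c \<in> A; x \<in> chart_image c; u \<noteq> 0; v \<noteq> 0\<rbrakk> \<Longrightarrow>
      euler_lagrange_form A S F c u (x, v) = - euler_lagrange_form A S F c v (x, u)"
  shows "two_form A (gyroscopic_form A S F)"
  unfolding two_form_def
proof (intro conjI allI ballI)
  have ex: "\<exists>c\<in>A. p \<in> fst c" for p using A by (auto simp: smooth_atlas_def)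
  have zero: "euler_lagrange_form A S F c 0 (snd c p, w) = 0" if "c \<in> A" "p \<in> fst c" "w \<noteq> 0" for c p w
    by (rule linear_0[OF linear_euler_lagrange_form[OF A that(1) F]])
      (use that in \<open>unfold slit_chart_image[OF A that(1)], auto simp: chart_image_def\<close>)
  fix p u v assume u: "u \<in> tangent_space A p" and v: "v \<in> tangent_space A p"
  obtain c where c: "c \<in> A" "p \<in> fst c" using ex by blast
  have "snd c p \<in> chart_image c" using c by (simp add: chart_image_def)
  then show "gyroscopic_form A S F p u v = - gyroscopic_form A S F p v u"
    using skew[OF c(1), of "snd c p" "u c" "v c"] zero[OF c]
    by (simp add: gyroscopic_form_eq[OF A c(1) S F c(2) u v] gyroscopic_form_eq[OF A c(1) S F c(2) v u])
next
  fix p u v w a b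
  assume "u \<in> tangent_space A p" "v \<in> tangent_space A p" "w \<in> tangent_space A p"
  define d where "d = (SOME c. c \<in> A \<and> p \<in> fst c)"
  have "\<exists>c. c \<in> A \<and> p \<in> fst c" using A unfolding smooth_atlas_def by blast
  then have d: "d \<in> A" "p \<in> fst d"
    using someI_ex[of "\<lambda>c. c \<in> A \<and> p \<in> fst c"] by (auto simp: d_def)
  have lin: "linear (\<lambda>u. euler_lagrange_form A S F d u (snd d p, w d))" if "w d \<noteq> 0"
    by (rule linear_euler_lagrange_form[OF A d(1) F])
      (use d that in \<open>unfold slit_chart_image[OF A d(1)], auto simp: chart_image_def\<close>)
  show "gyroscopic_form A S F p (\<lambda>c. a *\<^sub>R u c + b *\<^sub>R v c) w
      = a * gyroscopic_form A S F p u w + b * gyroscopic_form A S F p v w"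
    using linear_add[OF lin] linear_cmul[OF lin]
    by (simp add: gyroscopic_form_def Let_def d_def[symmetric])
next
  fix c i j assume c: "c \<in> A"
  let ?E = "euler_lagrange_form A S F c (axis i 1)"
  have "bounded_linear (\<lambda>x::real^'n. (x, 0::real^'n))"
    by (intro bounded_linear_Pair bounded_linear_zero bounded_linear_ident)
  then have "smooth_on (chart_image c) (\<lambda>x. ?E ((x, 0) + (0, axis j 1)))"
    by (rule smooth_on_compose_affine[OF open_chart_image[OF A c] _ _ smooth_euler_lagrange_form[OF A c S F]])
      (simp add: slit_chart_image[OF A c] axis_eq_0_iff)
  then have "smooth_on (chart_image c) (\<lambda>x. ?E (x, axis j 1))" by simp
  then show "smooth_on (chart_image c) (two_form_comp A c (gyroscopic_form A S F) i j)"
    by (rule smooth_on_cong[OF _ open_chart_image[OF A c]])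
      (simp add: gyroscopic_form_comp[OF A c S F])
qed

theorem theorem1p3:
  fixes A :: "('m::{t2_space, second_countable_topology}, real^'n) chart set"
    and S :: "('m, 'n) slit_field"
  assumes "smooth_atlas A" and "connected (UNIV :: 'm set)"
    and "spray A S"
  shows "gyroscopic A S \<longleftrightarrow>
    (\<exists>F. finsler A F \<and>
      (\<forall>c\<in>A. \<forall>z\<in>chart_image (slit_chart A c). \<forall>i j.
        nabla A c S
          (\<lambda>i j w. 1 / slit_rep A c F w *
             (metric_tensor A c F i j w - dy i (slit_rep A c F) w * dy j (slit_rep A c F) w))
          i j z = 0))"
proof
  note A = assms(1) and S = assms(3)
  assume "gyroscopic A S"
  then obtain \<omega> F where \<omega>: "two_form A \<omega>" and F: "finsler A F"
    and eq: "\<And>c x y i. \<lbrakk>c \<in> A; (x, y) \<in> chart_image (slit_chart A c)\<rbrakk> \<Longrightarrow>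
      euler_lagrange_form A S F c (axis i 1) (x, y) = (\<Sum>j\<in>UNIV. two_form_comp A c \<omega> i j x * y $ j)"
    unfolding gyroscopic_def euler_lagrange_form_axis by blast
  have "nabla A c S
          (\<lambda>i j w. 1 / slit_rep A c F w *
             (metric_tensor A c F i j w - dy i (slit_rep A c F) w * dy j (slit_rep A c F) w))
          i j z = 0" if c: "c \<in> A" and z: "z \<in> chart_image (slit_chart A c)" for c z i j
  proof -
    obtain x y where xy: "z = (x, y)" "x \<in> chart_image c" "y \<noteq> 0"
      using z by (auto simp: slit_chart_image[OF A c])
    have "dy k (euler_lagrange_form A S F c (axis i 1)) z = two_form_comp A c \<omega> i k x" for i k
      unfolding xy(1)
      by (rule dy_linear_on_fibre[OF smooth_on_differentiable[OF smooth_euler_lagrange_form[OF A c S F]] xy(3)])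
        (use xy eq[OF c] in \<open>auto simp: slit_chart_image[OF A c]\<close>)
    then show ?thesis
      using nabla_angular_metric[OF A c S F z, of i j] two_form_comp_skew[OF A c \<omega> xy(2), of i j] by simp
  qed
  then show "\<exists>F. finsler A F \<and>
      (\<forall>c\<in>A. \<forall>z\<in>chart_image (slit_chart A c). \<forall>i j.
        nabla A c S
          (\<lambda>i j w. 1 / slit_rep A c F w *
             (metric_tensor A c F i j w - dy i (slit_rep A c F) w * dy j (slit_rep A c F) w))
          i j z = 0)" using F by blast
next
  note A = assms(1) and S = assms(3)
  assume "\<exists>F. finsler A F \<and>
      (\<forall>c\<in>A. \<forall>z\<in>chart_image (slit_chart A c). \<forall>i j.
        nabla A c S
          (\<lambda>i j w. 1 / slit_rep A c F w *
             (metric_tensor A c F i j w - dy i (slit_rep A c F) w * dy j (slit_rep A c F) w))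
          i j z = 0)"
  then obtain F where F: "finsler A F" and nabla: "\<And>c z i j. \<lbrakk>c \<in> A; z \<in> chart_image (slit_chart A c)\<rbrakk> \<Longrightarrow>
        nabla A c S
          (\<lambda>i j w. 1 / slit_rep A c F w *
             (metric_tensor A c F i j w - dy i (slit_rep A c F) w * dy j (slit_rep A c F) w))
          i j z = 0" by blast
  have dskew: "dy j (euler_lagrange_form A S F c (axis i 1)) z = - dy i (euler_lagrange_form A S F c (axis j 1)) z"
    if "c \<in> A" "z \<in> chart_image (slit_chart A c)" for c z i j
    using nabla_angular_metric[OF A that(1) S F that(2), of i j] nabla[OF that, of i j] by linarith
  have skew: "euler_lagrange_form A S F c u (x, v) = - euler_lagrange_form A S F c v (x, u)"
    if "c \<in> A" "x \<in> chart_image c" "u \<noteq> 0" "v \<noteq> 0" for c x u v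
    by (rule euler_lagrange_form_skew[OF A that(1) S F dskew[OF that(1)] that(2-4)])
  have "euler_lagrange_form A S F c (axis i 1) (x, y)
      = (\<Sum>j\<in>UNIV. two_form_comp A c (gyroscopic_form A S F) i j x * y $ j)"
    if c: "c \<in> A" and xy: "(x, y) \<in> chart_image (slit_chart A c)" for c x y i
  proof -
    let ?E = "euler_lagrange_form A S F c"
    have x: "x \<in> chart_image c" and y: "y \<noteq> 0" using xy by (auto simp: slit_chart_image[OF A c])
    have ax: "(axis j 1 :: real^'n) \<noteq> 0" for j by (simp add: axis_eq_0_iff)
    have D: "(x, axis i 1) \<in> chart_image (slit_chart A c)"
      using x ax by (simp add: slit_chart_image[OF A c])
    \<comment> \<open>The form is linear in its vector argument, so skewness is used to bring \<open>y\<close> there and back.\<close>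
    have "?E (axis i 1) (x, y) = - ?E y (x, axis i 1)" by (rule skew[OF c x ax y])
    also have "\<dots> = - (\<Sum>j\<in>UNIV. y $ j * ?E (axis j 1) (x, axis i 1))"
      using linear_axis_expansion[OF linear_euler_lagrange_form[OF A c F D], of S y] by simp
    also have "\<dots> = (\<Sum>j\<in>UNIV. y $ j * - ?E (axis j 1) (x, axis i 1))"
      by (simp add: sum_negf)
    also have "\<dots> = (\<Sum>j\<in>UNIV. ?E (axis i 1) (x, axis j 1) * y $ j)"
      by (intro sum.cong refl) (simp add: skew[OF c x ax[of i] ax])
    finally show ?thesis by (simp add: gyroscopic_form_comp[OF A c S F x])
  qed
  then show "gyroscopic A S"
    unfolding gyroscopic_def using two_form_gyroscopic_form[OF A S F skew] F
    by (intro exI[of _ "gyroscopic_form A S F"] exI[of _ F]) (auto simp: euler_lagrange_form_axis)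
qed

end
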